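(* Let $d\in\mathbb N$ and let $\Delta=\langle p_1,p_2,p_3\rangle\subset\mathbb R^2$ be a nondegenerate triangle. Assume that at every interior vertex of the Wang–Shi split $\Delta_{WS_d}$ at most $d+1$ of the lines of the split intersect. Then $$\dim \mathbb S_d^{d-1}(\Delta_{WS_d})=\binom{d+2}{2}+3d(d-1),$$ where $3d(d-1)$ is the number of interior lines of the complete graph defining the split.
   Context: Wang–Shi split $WS_d$: divide each edge of $\Delta$ into $d$ equal segments, producing $3d$ boundary points (including the three vertices). Connect every pair of these $3d$ boundary points by a line segment (the complete graph on the boundary points); the resulting partition of $\Delta$ into polygons is denoted $\Delta_{WS_d}$, and its vertices are all intersection points of these segments (including the boundary points). The space $\mathbb S_d^{d-1}(\Delta_{WS_d})$ consists of all functions in $C^{d-1}(\Delta)$ whose restriction to each polygon of $\Delta_{WS_d}$ is a bivariate polynomial of total degree at most $d$. *)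

theory Defs
  imports "HOL-Analysis.Analysis" "HOL-Library.Function_Algebras"
begin

definition ws_boundary_points :: "nat \<Rightarrow> real^2 \<Rightarrow> real^2 \<Rightarrow> real^2 \<Rightarrow> (real^2) set" where
  "ws_boundary_points d p1 p2 p3 =
     (\<Union>(a, b) \<in> {(p1, p2), (p2, p3), (p3, p1)}.
        {a + (real k / real d) *\<^sub>R (b - a) | k. k < d})"

definition ws_segments :: "nat \<Rightarrow> real^2 \<Rightarrow> real^2 \<Rightarrow> real^2 \<Rightarrow> (real^2) set set" where
  "ws_segments d p1 p2 p3 =
     {closed_segment a b | a b. a \<in> ws_boundary_points d p1 p2 p3 \<and>
                                b \<in> ws_boundary_points d p1 p2 p3 \<and> a \<noteq> b}"

definition ws_cells :: "nat \<Rightarrow> real^2 \<Rightarrow> real^2 \<Rightarrow> real^2 \<Rightarrow> (real^2) set set" where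
  "ws_cells d p1 p2 p3 =
     closure ` components (convex hull {p1, p2, p3} - \<Union>(ws_segments d p1 p2 p3))"

definition bipoly_deg_le :: "nat \<Rightarrow> (real^2 \<Rightarrow> real) \<Rightarrow> bool" where
  "bipoly_deg_le d p \<longleftrightarrow> (\<exists>c :: nat \<Rightarrow> nat \<Rightarrow> real.
     \<forall>x. p x = (\<Sum>i\<le>d. \<Sum>j\<le>d - i. c i j * (x$1) ^ i * (x$2) ^ j))"

fun Ck_on :: "nat \<Rightarrow> (real^2) set \<Rightarrow> (real^2 \<Rightarrow> real) \<Rightarrow> bool" where
  "Ck_on 0 U f = continuous_on U f"
| "Ck_on (Suc k) U f =
     (continuous_on U f \<and> (\<forall>x\<in>U. f differentiable (at x)) \<and>
      (\<forall>i. Ck_on k U (\<lambda>x. frechet_derivative f (at x) (axis i 1))))"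

definition C_on_triangle :: "nat \<Rightarrow> (real^2) set \<Rightarrow> (real^2 \<Rightarrow> real) \<Rightarrow> bool" where
  "C_on_triangle r T f \<longleftrightarrow> continuous_on T f \<and> Ck_on r (interior T) f"

text \<open>The spline space S_d^{d-1}(Delta_WS_d); functions are normalised to vanish
  outside the triangle, so that they are identified with functions on Delta.\<close>
definition ws_spline_space :: "nat \<Rightarrow> real^2 \<Rightarrow> real^2 \<Rightarrow> real^2 \<Rightarrow> (real^2 \<Rightarrow> real) set" where
  "ws_spline_space d p1 p2 p3 =
     {f. (\<forall>x. x \<notin> convex hull {p1, p2, p3} \<longrightarrow> f x = 0) \<and>
         C_on_triangle (d - 1) (convex hull {p1, p2, p3}) f \<and>
         (\<forall>P \<in> ws_cells d p1 p2 p3. \<exists>p. bipoly_deg_le d p \<and> (\<forall>x\<in>P. f x = p x))}"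

definition fun_dim :: "(real^2 \<Rightarrow> real) set \<Rightarrow> nat" where
  "fun_dim S = vector_space.dim (\<lambda>c f. \<lambda>x. c * f x) S"

end

theory Submission
  imports Defs
begin

text \<open>Across a line with affine form \<open>\<lambda>\<close> two polynomial pieces of a spline of degree \<open>d\<close> and
  smoothness \<open>d - 1\<close> differ by a constant multiple of \<open>\<lambda> ^ d\<close>. Around a vertex where at most
  \<open>d + 1\<close> lines meet, the powers \<open>\<lambda> ^ d\<close> of these lines are linearly independent, which forces that
  multiple to be the same on both sides of the vertex, hence constant along each line. So every spline is
  a polynomial plus a combination of one truncated power \<open>max 0 \<lambda> ^ d\<close> per interior line, and
  these are linearly independent modulo polynomials.\<close>

section \<open>Bivariate polynomials\<close>

text \<open>The bound d + 1 is the dimension of the space of binary forms of degree d: that many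
  d-th powers of pairwise non-proportional linear forms are still independent, by a Vandermonde
  argument, and one more makes them dependent. The obstacle is that pieces are determined only off
  the lines and jumps only off the vertices, while connectedness arguments want whole chords and
  discs. It is met by a lemma on functions that are locally constant on a dense subset, and by
  finiteness of the vertices: an open convex planar set stays connected without them, so pieces are
  compared globally and not polygon by polygon. All this happens for lines in an open convex set.
  The triangle enters through one fact: a segment of the split that meets the interior is the whole
  intersection of the triangle with its line. Hence these segments and their lines correspond one to
  one, and truncated powers break only along the split. Their number is 3 d (d - 1) because such a
  segment joins one of d points of a side to one of the d - 1 inner points of the next side in
  cyclic order.\<close>

lemma bipoly_monom:
  assumes "i + j \<le> d"
  shows "bipoly_deg_le d (\<lambda>x. (x$1)^i * (x$2)^j)"
proof -
  have "(\<Sum>a\<le>d. \<Sum>b\<le>d - a. (if a = i \<and> b = j then 1 else 0) * (x$1)^a * (x$2)^b)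
        = (x$1)^i * (x$2)^j" for x :: "real^2"
  proof -
    have "(if a = i \<and> b = j then 1 else 0) * (x$1)^a * (x$2)^b
        = (if b = j then if a = i then (x$1)^i * (x$2)^j else 0 else 0)" for a b
      by simp
    then have "(\<Sum>a\<le>d. \<Sum>b\<le>d - a. (if a = i \<and> b = j then 1 else 0) * (x$1)^a * (x$2)^b)
        = (\<Sum>a\<le>d. if j \<le> d - a then if a = i then (x$1)^i * (x$2)^j else 0 else 0)"
      by (simp only: sum.delta finite_atMost atMost_iff)
    also have "\<dots> = (\<Sum>a\<le>d. if a = i then (x$1)^i * (x$2)^j else 0)"
      using assms by (intro sum.cong) auto
    also have "\<dots> = (x$1)^i * (x$2)^j"
      using assms by (subst sum.delta) auto
    finally show ?thesis .
  qed
  then show ?thesis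
    unfolding bipoly_deg_le_def
    by (intro exI[of _ "\<lambda>a b. if a = i \<and> b = j then 1 else 0"]) auto
qed

lemma bipoly_add:
  assumes "bipoly_deg_le d p" "bipoly_deg_le d q"
  shows "bipoly_deg_le d (\<lambda>x. p x + q x)"
proof -
  obtain c e where "\<forall>x. p x = (\<Sum>i\<le>d. \<Sum>j\<le>d - i. c i j * (x$1) ^ i * (x$2) ^ j)"
    "\<forall>x. q x = (\<Sum>i\<le>d. \<Sum>j\<le>d - i. e i j * (x$1) ^ i * (x$2) ^ j)"
    using assms unfolding bipoly_deg_le_def by blast
  then show ?thesis
    unfolding bipoly_deg_le_def
    by (intro exI[of _ "\<lambda>i j. c i j + e i j"]) (simp add: algebra_simps sum.distrib)
qed

lemma bipoly_cmul:
  assumes "bipoly_deg_le d p"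
  shows "bipoly_deg_le d (\<lambda>x. r * p x)"
proof -
  obtain c where "\<forall>x. p x = (\<Sum>i\<le>d. \<Sum>j\<le>d - i. c i j * (x$1) ^ i * (x$2) ^ j)"
    using assms unfolding bipoly_deg_le_def by blast
  then show ?thesis
    unfolding bipoly_deg_le_def
    by (intro exI[of _ "\<lambda>i j. r * c i j"]) (simp add: sum_distrib_left mult.assoc)
qed

lemma bipoly_const: "bipoly_deg_le d (\<lambda>x. r)"
  using bipoly_cmul[OF bipoly_monom[of 0 0 d], of r] by simp

lemma bipoly_diff:
  assumes "bipoly_deg_le d p" "bipoly_deg_le d q"
  shows "bipoly_deg_le d (\<lambda>x. p x - q x)"
  using bipoly_add[OF assms(1) bipoly_cmul[OF assms(2), of "-1"]] by simp

lemma bipoly_sum: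
  assumes "\<And>i. i \<in> A \<Longrightarrow> bipoly_deg_le d (p i)"
  shows "bipoly_deg_le d (\<lambda>x. \<Sum>i\<in>A. p i x)"
  using assms
  by (induction A rule: infinite_finite_induct) (auto intro: bipoly_add bipoly_const)

lemma bipoly_mult:
  assumes "bipoly_deg_le a p" "bipoly_deg_le b q"
  shows "bipoly_deg_le (a + b) (\<lambda>x. p x * q x)"
proof -
  obtain c e where c: "p = (\<lambda>x. \<Sum>i\<le>a. \<Sum>j\<le>a - i. c i j * (x$1) ^ i * (x$2) ^ j)"
    and e: "q = (\<lambda>x. \<Sum>i\<le>b. \<Sum>j\<le>b - i. e i j * (x$1) ^ i * (x$2) ^ j)"
    using assms unfolding bipoly_deg_le_def by blast
  have monom: "bipoly_deg_le (a + b) (\<lambda>x. (x$1) ^ i * (x$2) ^ j * q x)" if "i + j \<le> a" for i j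
  proof -
    have "bipoly_deg_le (a + b)
       (\<lambda>x. \<Sum>k\<le>b. \<Sum>l\<le>b - k. e k l * ((x$1) ^ (i + k) * (x$2) ^ (j + l)))"
      using that by (intro bipoly_sum bipoly_cmul bipoly_monom) auto
    moreover have "(x$1) ^ i * (x$2) ^ j * q x =
       (\<Sum>k\<le>b. \<Sum>l\<le>b - k. e k l * ((x$1) ^ (i + k) * (x$2) ^ (j + l)))" for x
      unfolding e sum_distrib_left by (intro sum.cong refl) (simp add: power_add)
    ultimately show ?thesis by simp
  qed
  have "bipoly_deg_le (a + b)
     (\<lambda>x. \<Sum>i\<le>a. \<Sum>j\<le>a - i. c i j * ((x$1) ^ i * (x$2) ^ j * q x))"
    by (intro bipoly_sum bipoly_cmul monom) auto
  moreover have "p x * q x = (\<Sum>i\<le>a. \<Sum>j\<le>a - i. c i j * ((x$1) ^ i * (x$2) ^ j * q x))" for x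
    unfolding c sum_distrib_right by (simp add: mult.assoc)
  ultimately show ?thesis by simp
qed

lemma bipoly_power:
  assumes "bipoly_deg_le a p"
  shows "bipoly_deg_le (m * a) (\<lambda>x. p x ^ m)"
  by (induction m) (auto intro: bipoly_const bipoly_mult[OF assms])

lemma bipoly_mono:
  assumes "bipoly_deg_le a p" "a \<le> b"
  shows "bipoly_deg_le b p"
  using bipoly_mult[OF assms(1) bipoly_const[of "b - a" 1]] assms(2) by simp

lemma bipoly_coord: "bipoly_deg_le 1 (\<lambda>x. x$(i::2))"
  using bipoly_monom[of 1 0 1] bipoly_monom[of 0 1 1] exhaust_2[of i] by auto

lemma bipoly_affine: "bipoly_deg_le 1 (\<lambda>x. n \<bullet> x - k)"
proof -
  have "bipoly_deg_le 1 (\<lambda>x. n$1 * x$1 + n$2 * x$2 - k)"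
    by (intro bipoly_diff bipoly_add bipoly_cmul bipoly_coord bipoly_const)
  then show ?thesis by (simp add: inner_vec_def sum_2)
qed

lemma bipoly_compose:
  assumes "bipoly_deg_le d p" "\<And>i::2. bipoly_deg_le 1 (\<lambda>x. A x $ i)"
  shows "bipoly_deg_le d (\<lambda>x. p (A x))"
proof -
  obtain c where c: "p = (\<lambda>x. \<Sum>i\<le>d. \<Sum>j\<le>d - i. c i j * (x$1) ^ i * (x$2) ^ j)"
    using assms unfolding bipoly_deg_le_def by blast
  have "bipoly_deg_le d (\<lambda>x. (A x $ 1) ^ i * (A x $ 2) ^ j)" if "i + j \<le> d" for i j
    using bipoly_mult[OF bipoly_power[OF assms(2), of i] bipoly_power[OF assms(2), of j]]
      that bipoly_mono[of "i * 1 + j * 1" _ d] by simp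
  then have "bipoly_deg_le d (\<lambda>x. \<Sum>i\<le>d. \<Sum>j\<le>d - i. c i j * ((A x $ 1) ^ i * (A x $ 2) ^ j))"
    by (intro bipoly_sum bipoly_cmul) auto
  then show ?thesis unfolding c by (simp add: mult.assoc)
qed

text \<open>The directions \<open>u\<close> and \<open>w\<close> are arbitrary:
  \<open>perp n\<close> and \<open>n\<close> give coordinates along and across a line, while a zero
  direction gives the restriction to a line.\<close>

lemma bipoly_coordinates:
  assumes "bipoly_deg_le d p"
  shows "\<exists>c. \<forall>s t. p (z + s *\<^sub>R u + t *\<^sub>R w) = (\<Sum>i\<le>d. \<Sum>j\<le>d - i. c i j * s ^ i * t ^ j)"
proof -
  have "bipoly_deg_le 1 (\<lambda>x. (z + x$1 *\<^sub>R u + x$2 *\<^sub>R w) $ i)" for i :: 2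
  proof -
    have "bipoly_deg_le 1 (\<lambda>x. z$i + u$i * x$1 + w$i * x$2)"
      by (intro bipoly_add bipoly_cmul bipoly_coord bipoly_const)
    then show ?thesis by (simp add: mult.commute)
  qed
  from bipoly_compose[OF assms this]
  obtain c where c: "\<And>x::real^2. p (z + x$1 *\<^sub>R u + x$2 *\<^sub>R w)
      = (\<Sum>i\<le>d. \<Sum>j\<le>d - i. c i j * (x$1) ^ i * (x$2) ^ j)"
    unfolding bipoly_deg_le_def by blast
  show ?thesis
    by (rule exI[of _ c]) (use c[of "vector [s, t]" for s t] in simp)
qed

lemma bipoly_line:
  assumes "bipoly_deg_le d p"
  shows "\<exists>P :: real poly. degree P \<le> d \<and> (\<forall>t. p (z + t *\<^sub>R w) = poly P t)"
proof -
  obtain c where c: "\<forall>s t. p (z + s *\<^sub>R w + t *\<^sub>R 0) = (\<Sum>i\<le>d. \<Sum>j\<le>d - i. c i j * s ^ i * t ^ j)"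
    using bipoly_coordinates[OF assms, of z w 0] by blast
  let ?P = "\<Sum>i\<le>d. monom (c i 0) i"
  have "degree ?P \<le> d"
    by (intro degree_sum_le) (auto intro: order.trans[OF degree_monom_le])
  moreover have "p (z + t *\<^sub>R w) = poly ?P t" for t
  proof -
    have "(\<Sum>j\<le>d - i. c i j * t ^ i * 0 ^ j) = c i 0 * t ^ i" for i
      by (subst sum.mono_neutral_right[of "{..d - i}" "{0}"]) auto
    then show ?thesis using c[rule_format, of t 0] by (simp add: poly_sum poly_monom)
  qed
  ultimately show ?thesis by blast
qed

text \<open>On the line from \<open>z\<close> to \<open>x\<close> the polynomial has infinitely many
  zeros near \<open>z\<close>, so it vanishes at \<open>x\<close> too.\<close>

lemma bipoly_eq_0_if_open:
  assumes "bipoly_deg_le d p" "open N" "z \<in> N" "\<And>x. x \<in> N \<Longrightarrow> p x = 0"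
  shows "p x = 0"
proof -
  obtain P where P: "\<And>t. p (z + t *\<^sub>R (x - z)) = poly P t"
    using bipoly_line[OF assms(1)] by blast
  have "open ((\<lambda>t. z + t *\<^sub>R (x - z)) -` N)"
    by (intro open_vimage assms(2)) (intro continuous_intros)
  moreover have "0 \<in> (\<lambda>t. z + t *\<^sub>R (x - z)) -` N" using assms(3) by simp
  ultimately obtain e where e: "e > 0" "ball 0 e \<subseteq> (\<lambda>t. z + t *\<^sub>R (x - z)) -` N"
    by (meson open_contains_ball)
  have "infinite (ball (0::real) e)"
    using e(1) by (simp add: ball_eq_greaterThanLessThan)
  moreover have "ball 0 e \<subseteq> {t. poly P t = 0}"
    using e(2) assms(4) unfolding P[symmetric] by blast
  ultimately have "P = 0" using poly_roots_finite finite_subset by blast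
  then show ?thesis using P[of 1] by simp
qed

text \<open>For fixed \<open>t\<close> this is a polynomial in \<open>s\<close>; its coefficients
  vanish for every \<open>t\<close> and are in turn polynomials in \<open>t\<close>.\<close>

lemma bipoly_coeffs_eq_0:
  fixes c :: "nat \<Rightarrow> nat \<Rightarrow> real"
  assumes "\<And>s t. (\<Sum>i\<le>d. \<Sum>j\<le>d - i. c i j * s ^ i * t ^ j) = 0"
    and "i + j \<le> d"
  shows "c i j = 0"
proof -
  have "(\<Sum>j\<le>d - i. c i j * t ^ j) = 0" for t
  proof -
    have "(\<Sum>i\<le>d. (\<Sum>j\<le>d - i. c i j * t ^ j) * s ^ i) = 0" for s
      using assms(1)[of s t] by (simp add: sum_distrib_right mult.assoc mult.commute[of "s ^ _"])
    then have "\<forall>s. (\<Sum>i\<le>d. (\<Sum>j\<le>d - i. c i j * t ^ j) * s ^ i) = 0" by blast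
    then have "\<forall>i\<le>d. (\<Sum>j\<le>d - i. c i j * t ^ j) = 0"
      by (simp only: polyfun_eq_0)
    then show ?thesis using assms(2) by simp
  qed
  then have "\<forall>j\<le>d - i. c i j = 0"
    using polyfun_eq_0[of "c i" "d - i"] by blast
  then show ?thesis using assms(2) by auto
qed

section \<open>Iterated partial derivatives\<close>

text \<open>On an open set derivatives depend only on nearby values, so \<open>Ck_on\<close> does
  not see how a function is continued outside, in particular the extension of splines by
  zero.\<close>

lemma Ck_on_cong:
  assumes "open U" "\<And>x. x \<in> U \<Longrightarrow> f x = g x" "Ck_on k U f"
  shows "Ck_on k U g"
  using assms(2,3)
proof (induction k arbitrary: f g)
  case 0
  then show ?case by (auto cong: continuous_on_cong)
next
  case (Suc k)
  have hd: "(g has_derivative frechet_derivative f (at x)) (at x)" if "x \<in> U" for x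
  proof -
    have "(f has_derivative frechet_derivative f (at x)) (at x)"
      using Suc.prems(2) that by (simp add: frechet_derivative_works[symmetric])
    then show ?thesis
      by (rule has_derivative_transform_within_open[OF _ assms(1) that]) (use Suc.prems(1) in auto)
  qed
  then have "frechet_derivative g (at x) = frechet_derivative f (at x)" if "x \<in> U" for x
    using frechet_derivative_at[OF hd[OF that]] by simp
  then have "Ck_on k U (\<lambda>x. frechet_derivative g (at x) (axis i 1))" for i
    using Suc.IH[of "\<lambda>x. frechet_derivative f (at x) (axis i 1)"] Suc.prems(2) by auto
  moreover have "continuous_on U g"
    using Suc.prems by (auto cong: continuous_on_cong)
  ultimately show ?case
    using hd unfolding Ck_on.simps differentiable_def by blast
qed

text \<open>Uniqueness of derivatives lets one computed by rules replace the choice made by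
  \<open>frechet_derivative\<close>.\<close>

lemma Ck_on_SucI:
  assumes "open U" "\<And>x. x \<in> U \<Longrightarrow> (f has_derivative f' x) (at x)"
    "\<And>i. Ck_on k U (\<lambda>x. f' x (axis i 1))"
  shows "Ck_on (Suc k) U f"
proof -
  have "frechet_derivative f (at x) = f' x" if "x \<in> U" for x
    using frechet_derivative_at[OF assms(2)[OF that]] by simp
  then have "Ck_on k U (\<lambda>x. frechet_derivative f (at x) (axis i 1))" for i
    by (intro Ck_on_cong[OF assms(1) _ assms(3)[of i]]) auto
  moreover have "continuous_on U f"
    using assms(2) by (meson continuous_at_imp_continuous_on has_derivative_continuous)
  ultimately show ?thesis
    using assms(2) unfolding Ck_on.simps differentiable_def by blast
qed

lemma Ck_on_mono: "Ck_on (Suc k) U f \<Longrightarrow> Ck_on k U f"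
  by (induction k arbitrary: f) auto

lemma Ck_on_subset: "Ck_on k U f \<Longrightarrow> V \<subseteq> U \<Longrightarrow> Ck_on k V f"
  by (induction k arbitrary: f) (auto intro: continuous_on_subset)

lemma Ck_on_continuous: "Ck_on k U f \<Longrightarrow> continuous_on U f"
  by (cases k) auto

lemma Ck_on_const:
  assumes "open U" shows "Ck_on k U (\<lambda>x. c)"
proof (induction k arbitrary: c)
  case (Suc k)
  show ?case
    by (rule Ck_on_SucI[OF assms, where f' = "\<lambda>x h. 0"]) (auto simp: Suc)
qed auto

lemma Ck_on_coord:
  assumes "open U" shows "Ck_on k U (\<lambda>x. x $ j)"
proof (cases k)
  case (Suc m)
  have "Ck_on (Suc m) U (\<lambda>x. x $ j)"
    by (rule Ck_on_SucI[OF assms, where f' = "\<lambda>x h. h $ j"])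
      (intro Ck_on_const assms bounded_linear_imp_has_derivative bounded_linear_vec_nth)+
  then show ?thesis using Suc by simp
qed (auto intro: continuous_intros)

lemma Ck_on_add:
  assumes "open U" "Ck_on k U f" "Ck_on k U g"
  shows "Ck_on k U (\<lambda>x. f x + g x)"
  using assms(2,3)
proof (induction k arbitrary: f g)
  case (Suc k)
  show ?case
  proof (rule Ck_on_SucI[OF assms(1)])
    show "((\<lambda>x. f x + g x) has_derivative
        (\<lambda>h. frechet_derivative f (at x) h + frechet_derivative g (at x) h)) (at x)"
      if "x \<in> U" for x
      using Suc.prems that by (intro has_derivative_add) (auto simp: frechet_derivative_works[symmetric])
  qed (use Suc in auto)
qed (auto intro: continuous_intros)

lemma Ck_on_mult:
  assumes "open U" "Ck_on k U f" "Ck_on k U g"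
  shows "Ck_on k U (\<lambda>x. f x * g x)"
  using assms(2,3)
proof (induction k arbitrary: f g)
  case (Suc k)
  show ?case
  proof (rule Ck_on_SucI[OF assms(1)])
    show "((\<lambda>x. f x * g x) has_derivative
        (\<lambda>h. f x * frechet_derivative g (at x) h + frechet_derivative f (at x) h * g x)) (at x)"
      if "x \<in> U" for x
      using Suc.prems that by (intro has_derivative_mult) (auto simp: frechet_derivative_works[symmetric])
    show "Ck_on k U (\<lambda>x. f x * frechet_derivative g (at x) (axis i 1)
        + frechet_derivative f (at x) (axis i 1) * g x)" for i
      using Suc.prems Ck_on_mono[OF Suc.prems(1)] Ck_on_mono[OF Suc.prems(2)]
      by (intro Ck_on_add assms(1) Suc.IH) auto
  qed
qed (auto intro: continuous_intros)

lemma Ck_on_sum: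
  assumes "open U" "\<And>i. i \<in> A \<Longrightarrow> Ck_on k U (f i)"
  shows "Ck_on k U (\<lambda>x. \<Sum>i\<in>A. f i x)"
  using assms(2)
  by (induction A rule: infinite_finite_induct) (auto intro: Ck_on_add Ck_on_const assms(1))

lemma Ck_on_power:
  assumes "open U" "Ck_on k U f"
  shows "Ck_on k U (\<lambda>x. f x ^ m)"
  by (induction m) (auto intro: Ck_on_const Ck_on_mult assms)

lemma Ck_on_bipoly:
  assumes "open U" "bipoly_deg_le d p"
  shows "Ck_on k U p"
proof -
  obtain c where c: "p = (\<lambda>x. \<Sum>i\<le>d. \<Sum>j\<le>d - i. c i j * (x$1) ^ i * (x$2) ^ j)"
    using assms unfolding bipoly_deg_le_def by blast
  show ?thesis unfolding c
    by (intro Ck_on_sum Ck_on_mult Ck_on_power Ck_on_coord Ck_on_const assms(1))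
qed

text \<open>\<open>Ck_on\<close> speaks of partial derivatives along the axes; linearity passes to
  any direction, such as the normal of a line across which a jump is analysed.\<close>

lemma Ck_on_directional:
  fixes n :: "real^2"
  assumes "open U" "Ck_on (Suc k) U f"
  shows "Ck_on k U (\<lambda>x. frechet_derivative f (at x) n)"
proof -
  have *: "Ck_on k U (\<lambda>x. \<Sum>i\<in>UNIV. n$i * frechet_derivative f (at x) (axis i 1))"
    using assms(2) by (intro Ck_on_sum Ck_on_mult Ck_on_const assms(1)) auto
  have "(\<Sum>i\<in>UNIV. n$i * frechet_derivative f (at x) (axis i 1))
      = frechet_derivative f (at x) n" if "x \<in> U" for x
  proof -
    interpret linear "frechet_derivative f (at x)"
      using assms(2) that by (intro linear_frechet_derivative) auto
    have "frechet_derivative f (at x) n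
        = frechet_derivative f (at x) (\<Sum>i\<in>UNIV. n$i *\<^sub>R axis i 1)"
      by (simp only: basis_expansion[of n, unfolded scalar_mult_eq_scaleR])
    also have "\<dots> = (\<Sum>i\<in>UNIV. n$i * frechet_derivative f (at x) (axis i 1))"
      by (simp only: sum scale real_scaleR_def)
    finally show ?thesis by simp
  qed
  then show ?thesis by (rule Ck_on_cong[OF assms(1) _ *])
qed

text \<open>The exponent is at least 2, which removes the corner at 0: there the difference quotient
  is bounded by \<open>max 0 h ^ n\<close>, which tends to 0.\<close>

lemma trunc_power_has_field_derivative:
  fixes t :: real
  assumes "n > 0"
  shows "((\<lambda>t. max 0 t ^ Suc n) has_field_derivative real (Suc n) * max 0 t ^ n) (at t)"
proof -
  consider "t > 0" | "t < 0" | "t = 0" by linarith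
  then show ?thesis
  proof cases
    case 1
    then have "((\<lambda>t. t ^ Suc n) has_field_derivative real (Suc n) * max 0 t ^ n) (at t)"
      using DERIV_pow[of "Suc n" t UNIV] by (simp only: diff_Suc_Suc diff_zero max_absorb2 less_imp_le)
    then show ?thesis
      by (rule has_field_derivative_transform_within_open[where S = "{0<..}"]) (use 1 in auto)
  next
    case 2
    then have "((\<lambda>t. 0) has_field_derivative real (Suc n) * max 0 t ^ n) (at t)"
      using assms by (simp only: max_absorb1 less_imp_le zero_power mult_zero_right DERIV_const)
    then show ?thesis
      by (rule has_field_derivative_transform_within_open[where S = "{..<0}"]) (use 2 in auto)
  next
    case 3
    have "((\<lambda>h::real. max 0 h ^ n) \<longlongrightarrow> max 0 0 ^ n) (at 0)"
      by (intro tendsto_intros)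
    then have *: "((\<lambda>h::real. max 0 h ^ n) \<longlongrightarrow> 0) (at 0)"
      using assms by (simp only: max.idem zero_power)
    have "norm ((max 0 (0 + h) ^ Suc n - max 0 0 ^ Suc n) / h) \<le> max 0 h ^ n" for h :: real
      by (cases "h > 0") (simp_all add: max_def)
    then have "((\<lambda>h::real. (max 0 (0 + h) ^ Suc n - max 0 0 ^ Suc n) / h) \<longlongrightarrow> 0) (at 0)"
      by (intro Lim_null_comparison[OF _ *] always_eventually allI)
    then show ?thesis
      using 3 assms unfolding DERIV_def by (simp only: max.idem zero_power mult_zero_right)
  qed
qed

text \<open>Each derivative lowers \<open>k\<close> and the exponent together and leaves
  \<open>m\<close> alone, which is why the exponent is written as
  \<open>Suc (k + m)\<close>.\<close>

lemma Ck_on_trunc_power: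
  assumes "open U"
  shows "Ck_on k U (\<lambda>x::real^2. max 0 (n \<bullet> x - c) ^ Suc (k + m))"
proof (induction k arbitrary: m)
  case (Suc k)
  show ?case
  proof (rule Ck_on_SucI[OF assms])
    fix x :: "real^2"
    have "((\<lambda>x. n \<bullet> x - c) has_derivative (\<lambda>h. n \<bullet> h)) (at x)"
      by (auto intro!: derivative_eq_intros)
    from has_derivative_compose[OF this
        trunc_power_has_field_derivative[of "Suc (k + m)", OF zero_less_Suc, unfolded has_field_derivative_def]]
    show "((\<lambda>x. max 0 (n \<bullet> x - c) ^ Suc (Suc k + m)) has_derivative
       (\<lambda>h. real (Suc (Suc (k + m))) * max 0 (n \<bullet> x - c) ^ Suc (k + m) * (n \<bullet> h))) (at x)"
      by simp
  qed (intro Ck_on_mult Ck_on_const assms Suc)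
next
  case 0
  have "continuous_on U (\<lambda>x::real^2. max 0 (n \<bullet> x - c) ^ Suc m)"
    by (intro continuous_intros)
  then show ?case by simp
qed

section \<open>The jump across a line\<close>

lemma one_sided_limit_poly:
  fixes P :: "real poly" and z w :: "real^2"
  assumes "open U" "continuous_on U f" "z \<in> U" "e > 0"
    and "\<And>t. 0 < t \<Longrightarrow> t < e \<Longrightarrow> f (z + t *\<^sub>R w) = poly P t"
  shows "poly P 0 = f z"
proof -
  have "isCont f z"
    using assms(1-3) by (simp add: continuous_on_eq_continuous_at)
  moreover have "((\<lambda>t. z + t *\<^sub>R w) \<longlongrightarrow> z + 0 *\<^sub>R w) (at_right 0)"
    by (intro tendsto_intros)
  then have "((\<lambda>t. z + t *\<^sub>R w) \<longlongrightarrow> z) (at_right 0)" by simp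
  ultimately have lim: "((\<lambda>t. f (z + t *\<^sub>R w)) \<longlongrightarrow> f z) (at_right 0)"
    by (rule isCont_tendsto_compose)
  have "((\<lambda>t. poly P t) \<longlongrightarrow> poly P 0) (at_right 0)"
    by (intro tendsto_poly tendsto_ident_at)
  moreover have "eventually (\<lambda>t. f (z + t *\<^sub>R w) = poly P t) (at_right 0)"
    unfolding eventually_at_right_field using assms(4,5) by auto
  ultimately have "((\<lambda>t. f (z + t *\<^sub>R w)) \<longlongrightarrow> poly P 0) (at_right 0)"
    using tendsto_cong by fast
  then show ?thesis
    using lim by (rule tendsto_unique[OF trivial_limit_at_right_real])
qed

text \<open>Induction on \<open>j\<close>, replacing \<open>f\<close> by its derivative along
  \<open>w\<close>: on either side of \<open>z\<close> this differentiates the polynomial. For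
  \<open>j = 0\<close> both one-sided limits equal \<open>f z\<close>.\<close>

lemma Ck_on_line_pderiv:
  fixes P Q :: "real poly" and z w :: "real^2"
  assumes "open U" "Ck_on k U f" "z \<in> U" "e > 0"
    and "\<And>t. \<bar>t\<bar> < e \<Longrightarrow> z + t *\<^sub>R w \<in> U"
    and "\<And>t. 0 < t \<Longrightarrow> t < e \<Longrightarrow> f (z + t *\<^sub>R w) = poly P t"
    and "\<And>t. - e < t \<Longrightarrow> t < 0 \<Longrightarrow> f (z + t *\<^sub>R w) = poly Q t"
    and "j \<le> k"
  shows "poly ((pderiv ^^ j) P) 0 = poly ((pderiv ^^ j) Q) 0"
  using assms(2,6-8)
proof (induction j arbitrary: k f P Q)
  case 0
  have c: "continuous_on U f" using 0 by (auto intro: Ck_on_continuous)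
  have "poly P 0 = f z"
    by (rule one_sided_limit_poly[OF assms(1) c assms(3,4) 0(2)])
  \<comment> \<open>The left limit is a right limit in direction \<open>- w\<close>, with
    \<open>Q\<close> composed with the reflection of \<open>t\<close>.\<close>
  moreover have "poly (pcompose Q [:0, -1:]) 0 = f z"
    by (rule one_sided_limit_poly[OF assms(1) c assms(3,4), of "- w"])
      (use 0(3)[of "- t" for t] in \<open>simp add: poly_pcompose\<close>)
  ultimately show ?case by (simp add: poly_pcompose)
next
  case (Suc j)
  then obtain m where m: "k = Suc m" "j \<le> m" by (cases k) auto
  define g where "g = (\<lambda>x. frechet_derivative f (at x) w)"
  have "Ck_on m U g"
    unfolding g_def using Suc.prems(1) m by (intro Ck_on_directional assms(1)) simp
  moreover have der: "g (z + t *\<^sub>R w) = poly (pderiv R) t"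
    if "\<bar>t\<bar> < e" "open S" "t \<in> S" "\<And>t. t \<in> S \<Longrightarrow> f (z + t *\<^sub>R w) = poly R t" for t S R
  proof -
    have "z + t *\<^sub>R w \<in> U" using assms(5) that by blast
    then have "(f has_derivative frechet_derivative f (at (z + t *\<^sub>R w))) (at (z + t *\<^sub>R w))"
      using Suc.prems(1) m by (simp add: frechet_derivative_works[symmetric])
    moreover have "((\<lambda>t. z + t *\<^sub>R w) has_derivative (\<lambda>h. h *\<^sub>R w)) (at t)"
      by (auto intro!: derivative_eq_intros)
    from has_derivative_compose[OF this] calculation have d: "((\<lambda>t. f (z + t *\<^sub>R w)) has_derivative
        (\<lambda>h. frechet_derivative f (at (z + t *\<^sub>R w)) (h *\<^sub>R w))) (at t)"
      by blast
    have "linear (frechet_derivative f (at (z + t *\<^sub>R w)))"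
      using Suc.prems(1) m \<open>z + t *\<^sub>R w \<in> U\<close> by (intro linear_frechet_derivative) auto
    then have "(\<lambda>h. frechet_derivative f (at (z + t *\<^sub>R w)) (h *\<^sub>R w)) = (*) (g (z + t *\<^sub>R w))"
      by (auto simp: g_def linear_scale)
    with d have "((\<lambda>t. f (z + t *\<^sub>R w)) has_field_derivative g (z + t *\<^sub>R w)) (at t)"
      by (simp add: has_field_derivative_def)
    then have "(poly R has_field_derivative g (z + t *\<^sub>R w)) (at t)"
      by (rule has_field_derivative_transform_within_open[OF _ that(2,3)]) (use that(4) in auto)
    then show ?thesis using poly_DERIV DERIV_unique by blast
  qed
  have "g (z + t *\<^sub>R w) = poly (pderiv P) t" if "0 < t" "t < e" for t
    using that by (intro der[where S = "{0<..<e}"]) (auto intro: Suc.prems(2))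
  moreover have "g (z + t *\<^sub>R w) = poly (pderiv Q) t" if "- e < t" "t < 0" for t
    using that by (intro der[where S = "{-e<..<0}"]) (auto intro: Suc.prems(3))
  ultimately have "poly ((pderiv ^^ j) (pderiv P)) 0 = poly ((pderiv ^^ j) (pderiv Q)) 0"
    using m(2) by (rule Suc.IH)
  then show ?case by (simp add: funpow_swap1)
qed

lemma sum_triangle_swap:
  fixes F :: "nat \<Rightarrow> nat \<Rightarrow> real"
  shows "(\<Sum>i\<le>d. \<Sum>j\<le>d - i. F i j) = (\<Sum>j\<le>d. \<Sum>i\<le>d - j. F i j)"
proof -
  have "(\<Sum>i\<le>d. \<Sum>j\<le>d - i. F i j) = (\<Sum>i\<in>{..d}. \<Sum>j\<in>{j \<in> {..d}. i + j \<le> d}. F i j)"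
    by (intro sum.cong) auto
  also have "\<dots> = (\<Sum>j\<in>{..d}. \<Sum>i\<in>{i \<in> {..d}. i + j \<le> d}. F i j)"
    by (rule sum.swap_restrict) auto
  also have "\<dots> = (\<Sum>j\<le>d. \<Sum>i\<le>d - j. F i j)"
    by (intro sum.cong) auto
  finally show ?thesis .
qed

text \<open>Rotation by a right angle: \<open>perp n\<close> is the direction of the lines with
  normal \<open>n\<close>.\<close>

definition perp :: "real^2 \<Rightarrow> real^2" where "perp n = vector [- (n$2), n$1]"

lemma inner_perp: "n \<bullet> perp n = 0" "perp n \<bullet> n = 0"
  by (simp_all add: perp_def inner_vec_def sum_2)

lemma perp_eq_0_iff [simp]: "perp n = 0 \<longleftrightarrow> n = 0"
  by (auto simp: perp_def vec_eq_iff forall_2)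

text \<open>\<open>n\<close> and \<open>perp n\<close> are orthogonal and of equal length, hence the
  common denominator.\<close>

lemma perp_decomposition:
  assumes "n \<noteq> 0"
  shows "x = ((perp n \<bullet> x) / (n \<bullet> n)) *\<^sub>R perp n + ((n \<bullet> x) / (n \<bullet> n)) *\<^sub>R n"
proof -
  have "x$1 = ((a * x$2 - b * x$1) / (a * a + b * b)) * - b + ((a * x$1 + b * x$2) / (a * a + b * b)) * a"
    "x$2 = ((a * x$2 - b * x$1) / (a * a + b * b)) * a + ((a * x$1 + b * x$2) / (a * a + b * b)) * b"
    if "a * a + b * b \<noteq> 0" for a b :: real
  proof -
    have distrib: "(u * c + v * e) / m = u / m * c + v / m * e" for u v c e m :: real
      by (simp add: add_divide_distrib)
    have "(a * a + b * b) * x$1 = (a * x$2 - b * x$1) * - b + (a * x$1 + b * x$2) * a"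
      "(a * a + b * b) * x$2 = (a * x$2 - b * x$1) * a + (a * x$1 + b * x$2) * b"
      by (simp_all add: algebra_simps)
    then have "x$1 = ((a * x$2 - b * x$1) * - b + (a * x$1 + b * x$2) * a) / (a * a + b * b)"
      "x$2 = ((a * x$2 - b * x$1) * a + (a * x$1 + b * x$2) * b) / (a * a + b * b)"
      using that by (simp_all add: nonzero_eq_divide_eq mult.commute del: sum_squares_eq_zero_iff)
    then show "x$1 = ((a * x$2 - b * x$1) / (a * a + b * b)) * - b + ((a * x$1 + b * x$2) / (a * a + b * b)) * a"
      "x$2 = ((a * x$2 - b * x$1) / (a * a + b * b)) * a + ((a * x$1 + b * x$2) / (a * a + b * b)) * b"
      by (simp_all only: distrib)
  qed
  from this[of "n$1" "n$2"] show ?thesis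
    using assms
    by (simp add: perp_def vec_eq_iff forall_2 inner_vec_def sum_2 sum_squares_eq_zero_iff algebra_simps)
qed

text \<open>In coordinates \<open>(s, t)\<close> along and across the line, matching the normal derivatives of order
  less than \<open>d\<close> at all points of the line removes every monomial of the difference but \<open>t ^ d\<close>.\<close>

lemma jump_eq_power:
  fixes n :: "real^2"
  assumes "open B" "Ck_on (d - 1) B f" "bipoly_deg_le d p" "bipoly_deg_le d q"
    and "n \<noteq> 0" "z \<in> B" "n \<bullet> z = k"
    and fp: "\<And>x. x \<in> B \<Longrightarrow> n \<bullet> x > k \<Longrightarrow> f x = p x"
    and fq: "\<And>x. x \<in> B \<Longrightarrow> n \<bullet> x < k \<Longrightarrow> f x = q x"
  shows "\<exists>c. \<forall>x. p x - q x = c * (n \<bullet> x - k) ^ d"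
proof -
  have nn: "n \<bullet> n > 0" using assms(5) by simp
  obtain e where e: "e > 0" "ball z e \<subseteq> B"
    using assms(1,6) open_contains_ball by blast
  have "perp n \<noteq> 0" using assms(5) by simp
  \<comment> \<open>Half of the radius for each coordinate, so that the box of all (s, t) below
    these bounds stays in the ball.\<close>
  define a where "a = e / (2 * norm (perp n))"
  define b where "b = e / (2 * norm n)"
  have ab: "a > 0" "b > 0"
    using e(1) assms(5) \<open>perp n \<noteq> 0\<close> by (simp_all add: a_def b_def)
  have inB: "z + s *\<^sub>R perp n + t *\<^sub>R n \<in> B" if "\<bar>s\<bar> < a" "\<bar>t\<bar> < b" for s t
  proof -
    have "norm (s *\<^sub>R perp n + t *\<^sub>R n) \<le> \<bar>s\<bar> * norm (perp n) + \<bar>t\<bar> * norm n"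
      by (rule norm_triangle_le) simp
    moreover have "\<bar>s\<bar> * norm (perp n) < e / 2" "\<bar>t\<bar> * norm n < e / 2"
      using that \<open>perp n \<noteq> 0\<close> assms(5) by (simp_all add: a_def b_def field_simps)
    ultimately have "norm (s *\<^sub>R perp n + t *\<^sub>R n) < e" by linarith
    then have "z + s *\<^sub>R perp n + t *\<^sub>R n \<in> ball z e"
      unfolding add.assoc mem_ball dist_norm norm_minus_commute[of z] by (simp only: add_diff_cancel_left')
    then show ?thesis using e(2) by blast
  qed
  have lam: "n \<bullet> (z + s *\<^sub>R perp n + t *\<^sub>R n) = k + t * (n \<bullet> n)" for s t
    using assms(7) by (simp add: inner_add_right inner_perp)
  obtain c where c: "\<forall>s t. p (z + s *\<^sub>R perp n + t *\<^sub>R n) - q (z + s *\<^sub>R perp n + t *\<^sub>R n)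
      = (\<Sum>i\<le>d. \<Sum>j\<le>d - i. c i j * s ^ i * t ^ j)"
    using bipoly_coordinates[OF bipoly_diff[OF assms(3,4)], of z "perp n" n] by (rule exE)
  define C where "C = (\<lambda>s j. \<Sum>i\<le>d - j. c i j * s ^ i)"
  have c': "p (z + s *\<^sub>R perp n + t *\<^sub>R n) - q (z + s *\<^sub>R perp n + t *\<^sub>R n)
      = (\<Sum>j\<le>d. C s j * t ^ j)" for s t
    unfolding c[rule_format] C_def sum_distrib_right by (rule sum_triangle_swap)
  \<comment> \<open>For fixed \<open>s\<close>, \<open>C s j\<close> is the coefficient of t ^ j in
    the difference of the two pieces, so matching derivatives of order \<open>j\<close> at t = 0
    annihilate it.\<close>
  have C0: "C s j = 0" if "\<bar>s\<bar> < a" "j < d" for s j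
  proof -
    obtain P Q where P: "\<forall>t. p (z + s *\<^sub>R perp n + t *\<^sub>R n) = poly P t"
      and Q: "\<forall>t. q (z + s *\<^sub>R perp n + t *\<^sub>R n) = poly Q t"
      using bipoly_line[OF assms(3), of "z + s *\<^sub>R perp n" n]
        bipoly_line[OF assms(4), of "z + s *\<^sub>R perp n" n] by blast
    have "poly ((pderiv ^^ j) P) 0 = poly ((pderiv ^^ j) Q) 0"
    proof (rule Ck_on_line_pderiv[OF assms(1,2) _ ab(2)])
      show "z + s *\<^sub>R perp n \<in> B" using inB[of s 0] that ab by simp
      show "z + s *\<^sub>R perp n + t *\<^sub>R n \<in> B" if "\<bar>t\<bar> < b" for t
        using inB that \<open>\<bar>s\<bar> < a\<close> by blast
      fix t
      have in': "z + s *\<^sub>R perp n + t *\<^sub>R n \<in> B" if "\<bar>t\<bar> < b"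
        using inB that \<open>\<bar>s\<bar> < a\<close> by blast
      show "f (z + s *\<^sub>R perp n + t *\<^sub>R n) = poly P t" if "0 < t" "t < b"
      proof -
        have "n \<bullet> (z + s *\<^sub>R perp n + t *\<^sub>R n) > k"
          unfolding lam using that(1) nn by simp
        then show ?thesis using fp in' that P by simp
      qed
      show "f (z + s *\<^sub>R perp n + t *\<^sub>R n) = poly Q t" if "- b < t" "t < 0"
      proof -
        have "n \<bullet> (z + s *\<^sub>R perp n + t *\<^sub>R n) < k"
          unfolding lam using mult_neg_pos[OF that(2) nn] by simp
        then show ?thesis using fq in' that Q by simp
      qed
      show "j \<le> d - 1" using that by simp
    qed
    then have "coeff (P - Q) j = 0"
      by (simp add: poly_0_coeff_0 coeff_higher_pderiv pochhammer_eq_0_iff)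
    moreover have "P - Q = (\<Sum>j\<le>d. monom (C s j) j)"
    proof -
      have "poly (P - Q) t = poly (\<Sum>j\<le>d. monom (C s j) j) t" for t
        using c'[of s t] P Q by (simp add: poly_sum poly_monom)
      then show ?thesis by (simp add: poly_eq_poly_eq_iff[symmetric] fun_eq_iff)
    qed
    ultimately show ?thesis using that by (simp add: coeff_sum sum.delta)
  qed
  \<comment> \<open>\<open>C s j\<close> is a polynomial in \<open>s\<close> that vanishes on an
    interval, so its coefficients vanish as well.\<close>
  have c0: "c i j = 0" if "j < d" "i \<le> d - j" for i j
  proof -
    let ?R = "\<Sum>i\<le>d - j. monom (c i j) i"
    have "{- a<..<a} \<subseteq> {s. poly ?R s = 0}"
      using C0[OF _ that(1)] by (auto simp: poly_sum poly_monom C_def)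
    moreover have "infinite {- a<..<a}" using ab by simp
    ultimately have "?R = 0" using poly_roots_finite finite_subset by blast
    then have "coeff ?R i = 0" by simp
    then show ?thesis using that by (simp add: coeff_sum sum.delta)
  qed
  \<comment> \<open>Only \<open>j = d\<close> survives, and the degree bound then leaves only
    \<open>i = 0\<close>.\<close>
  have pq: "p (z + s *\<^sub>R perp n + t *\<^sub>R n) - q (z + s *\<^sub>R perp n + t *\<^sub>R n) = c 0 d * t ^ d" for s t
  proof -
    have "(\<Sum>j\<le>d. C s j * t ^ j) = (\<Sum>j\<in>{d}. C s j * t ^ j)"
      by (rule sum.mono_neutral_right) (auto simp: C_def c0 intro!: sum.neutral)
    then show ?thesis using c'[of s t] by (simp add: C_def)
  qed
  have "p x - q x = c 0 d / (n \<bullet> n) ^ d * (n \<bullet> x - k) ^ d" for x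
  proof -
    define s t where "s = (perp n \<bullet> (x - z)) / (n \<bullet> n)" and "t = (n \<bullet> (x - z)) / (n \<bullet> n)"
    have "x - z = s *\<^sub>R perp n + t *\<^sub>R n"
      unfolding s_def t_def by (rule perp_decomposition[OF assms(5)])
    then have "x = z + s *\<^sub>R perp n + t *\<^sub>R n" by (simp only: diff_eq_eq ac_simps)
    then have "p x - q x = c 0 d * t ^ d" using pq[of s t] by (simp only:)
    also have "t = (n \<bullet> x - k) / (n \<bullet> n)" using assms(7) by (simp add: t_def inner_diff_right)
    finally show ?thesis by (simp add: power_divide)
  qed
  then show ?thesis by blast
qed

text \<open>Along the points w + r perp w each form is, up to a factor, 1 + r g with slope
  \<open>g\<close>. Comparing coefficients of r ^ k for k up to \<open>d\<close> gives a Vandermonde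
  system in the slopes, which are distinct; at most \<open>d + 1\<close> nodes are separated by
  Lagrange polynomials of degree at most \<open>d\<close>.\<close>

lemma powers_independent:
  fixes n :: "'i \<Rightarrow> real^2"
  assumes "finite I" "card I \<le> d + 1" "\<And>i. i \<in> I \<Longrightarrow> n i \<bullet> w \<noteq> 0"
    and indep: "\<And>i j x. i \<in> I \<Longrightarrow> j \<in> I \<Longrightarrow> i \<noteq> j \<Longrightarrow> n i \<bullet> x = 0 \<Longrightarrow> n j \<bullet> x = 0 \<Longrightarrow> x = 0"
    and zero: "\<And>x. (\<Sum>i\<in>I. a i * (n i \<bullet> x) ^ d) = 0"
    and i: "i \<in> I"
  shows "a i = 0"
proof -
  define g where "g = (\<lambda>i. (n i \<bullet> perp w) / (n i \<bullet> w))"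
  define b where "b = (\<lambda>i. a i * (n i \<bullet> w) ^ d)"
  have "w \<noteq> 0" using assms(3)[OF i] by auto
  have inj: "inj_on g I"
  proof (rule inj_onI, rule ccontr)
    fix i j assume ij: "i \<in> I" "j \<in> I" "g i = g j" "i \<noteq> j"
    \<comment> \<open>This vector is annihilated by \<open>n i\<close>, and if the slopes agree by
      \<open>n j\<close> as well; its \<open>perp w\<close> component is not zero.\<close>
    let ?x = "g i *\<^sub>R w - perp w"
    have "n i \<bullet> ?x = 0"
      using assms(3)[OF ij(1)] by (simp add: g_def inner_diff_right)
    moreover have "n j \<bullet> ?x = 0"
      using assms(3)[OF ij(2)]
      by (subst ij(3)) (simp add: g_def inner_diff_right)
    ultimately have "?x = 0" using indep ij by blast
    then have "perp w \<bullet> ?x = 0" by simp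
    then have "perp w \<bullet> perp w = 0" by (simp add: inner_diff_right inner_perp)
    then show False using \<open>w \<noteq> 0\<close> by simp
  qed
  have "(\<Sum>i\<in>I. b i * g i ^ k) = 0" if "k \<le> d" for k
  proof -
    have "(\<Sum>k\<le>d. (of_nat (d choose k) * (\<Sum>i\<in>I. b i * g i ^ k)) * r ^ k) = 0" for r
    proof -
      have "0 = (\<Sum>i\<in>I. a i * (n i \<bullet> (w + r *\<^sub>R perp w)) ^ d)"
        using zero by simp
      also have "\<dots> = (\<Sum>i\<in>I. b i * (r * g i + 1) ^ d)"
      proof (intro sum.cong refl)
        fix i assume "i \<in> I"
        then have "n i \<bullet> (w + r *\<^sub>R perp w) = (n i \<bullet> w) * (r * g i + 1)"
          using assms(3) by (simp add: g_def inner_add_right field_simps)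
        then show "a i * (n i \<bullet> (w + r *\<^sub>R perp w)) ^ d = b i * (r * g i + 1) ^ d"
          by (simp add: b_def power_mult_distrib)
      qed
      also have "\<dots> = (\<Sum>i\<in>I. \<Sum>k\<le>d. of_nat (d choose k) * (b i * g i ^ k) * r ^ k)"
        unfolding binomial_ring by (simp add: sum_distrib_left power_mult_distrib mult_ac)
      also have "\<dots> = (\<Sum>k\<le>d. (of_nat (d choose k) * (\<Sum>i\<in>I. b i * g i ^ k)) * r ^ k)"
        by (subst sum.swap) (simp add: sum_distrib_left sum_distrib_right)
      finally show ?thesis by simp
    qed
    then have "\<forall>r. (\<Sum>k\<le>d. (of_nat (d choose k) * (\<Sum>i\<in>I. b i * g i ^ k)) * r ^ k) = 0"
      by blast
    then have "of_nat (d choose k) * (\<Sum>i\<in>I. b i * g i ^ k) = 0"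
      using that unfolding polyfun_eq_0 by blast
    then show ?thesis using that by simp
  qed
  then have pol: "(\<Sum>i\<in>I. b i * poly q (g i)) = 0" if "degree q \<le> d" for q
  proof -
    have "(\<Sum>i\<in>I. b i * poly q (g i)) = (\<Sum>i\<in>I. \<Sum>k\<le>degree q. coeff q k * (b i * g i ^ k))"
      by (simp add: poly_altdef sum_distrib_left mult_ac)
    also have "\<dots> = (\<Sum>k\<le>degree q. coeff q k * (\<Sum>i\<in>I. b i * g i ^ k))"
      by (subst sum.swap) (simp add: sum_distrib_left)
    also have "\<dots> = 0"
      using that \<open>\<And>k. k \<le> d \<Longrightarrow> (\<Sum>i\<in>I. b i * g i ^ k) = 0\<close> by (intro sum.neutral) auto
    finally show ?thesis .
  qed
  \<comment> \<open>Lagrange numerator: it vanishes at every slope except that of \<open>i\<close>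
    and has degree \<open>card I - 1\<close>.\<close>
  let ?q = "\<Prod>j\<in>I - {i}. [:- g j, 1:]"
  have "degree ?q \<le> d"
    using degree_prod_sum_le[of "I - {i}" "\<lambda>j. [:- g j, 1:]"] assms(1,2) i by simp
  then have "0 = (\<Sum>j\<in>I. b j * poly ?q (g j))" using pol by simp
  also have "\<dots> = b i * poly ?q (g i)"
  proof -
    have "poly ?q (g j) = 0" if "j \<in> I" "j \<noteq> i" for j
      using that assms(1) by (auto simp: poly_prod)
    then show ?thesis
      by (subst sum.remove[OF assms(1) i]) (simp add: sum.neutral)
  qed
  finally have "b i = 0 \<or> poly ?q (g i) = 0" by simp
  moreover have "poly ?q (g i) \<noteq> 0"
    using assms(1) inj i by (auto simp: poly_prod inj_on_def)
  ultimately show ?thesis using assms(3)[OF i] by (simp add: b_def)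
qed

lemma generic_direction:
  fixes n :: "'i \<Rightarrow> real^2"
  assumes "finite I" "\<And>i. i \<in> I \<Longrightarrow> n i \<noteq> 0"
  shows "\<exists>w. \<forall>i\<in>I. n i \<bullet> w \<noteq> 0"
proof -
  \<comment> \<open>Each form excludes at most one \<open>t\<close> for the direction (1, t). If
    \<open>n i $ 2 = 0\<close> the quotient is 0 by convention, a harmless exclusion, since then
    \<open>n i $ 1\<close> is nonzero and every \<open>t\<close> is admissible.\<close>
  have "finite (\<Union>i\<in>I. {- (n i $ 1) / (n i $ 2)})" using assms(1) by blast
  then obtain t where t: "t \<notin> (\<Union>i\<in>I. {- (n i $ 1) / (n i $ 2)})"
    using infinite_UNIV_char_0 ex_new_if_finite by blast
  have "n i \<bullet> vector [1, t] \<noteq> 0" if "i \<in> I" for i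
  proof
    assume "n i \<bullet> vector [1, t] = 0"
    then have "n i $ 1 + n i $ 2 * t = 0" by (simp add: inner_vec_def sum_2)
    moreover have "t \<noteq> - (n i $ 1) / (n i $ 2)" using t that by blast
    ultimately have "n i $ 2 = 0" "n i $ 1 = 0"
      by (cases "n i $ 2 = 0"; simp add: field_simps)+
    then show False using assms(2)[OF that] by (simp add: vec_eq_iff forall_2)
  qed
  then show ?thesis by blast
qed

text \<open>\<open>g\<close> is meaningful on \<open>D\<close> only. Its local value near a point of
  \<open>K\<close> is well defined because \<open>D\<close> meets every neighbourhood, and this
  local value \<open>h\<close> is locally constant on all of the connected set
  \<open>K\<close>.\<close>

lemma connected_dense_locally_const:
  fixes g :: "'a::topological_space \<Rightarrow> 'b"
  assumes "connected K"
    and const: "\<And>z. z \<in> K \<Longrightarrow> \<exists>N. open N \<and> z \<in> N \<and> (\<forall>x\<in>N \<inter> D. \<forall>y\<in>N \<inter> D. g x = g y)"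
    and dense: "\<And>z N. z \<in> K \<Longrightarrow> open N \<Longrightarrow> z \<in> N \<Longrightarrow> N \<inter> D \<noteq> {}"
    and xy: "x \<in> K \<inter> D" "y \<in> K \<inter> D"
  shows "g x = g y"
proof -
  define lim where "lim z c \<longleftrightarrow> (\<exists>N. open N \<and> z \<in> N \<and> (\<forall>x\<in>N \<inter> D. g x = c))" for z c
  define h where "h z = (SOME c. lim z c)" for z
  have ex: "\<exists>c. lim z c" if z: "z \<in> K" for z
  proof -
    obtain N where N: "open N" "z \<in> N" "\<forall>x\<in>N \<inter> D. \<forall>y\<in>N \<inter> D. g x = g y"
      using const[OF z] by (elim exE conjE)
    obtain x where "x \<in> N \<inter> D" using dense[OF z N(1,2)] by (meson ex_in_conv)
    then have "lim z (g x)" unfolding lim_def using N by meson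
    then show ?thesis ..
  qed
  have unique: "c = c'" if z: "z \<in> K" "lim z c" "lim z c'" for z c c'
  proof -
    obtain N where N: "open N" "z \<in> N" "\<forall>x\<in>N \<inter> D. g x = c"
      using z(2) unfolding lim_def by (elim exE conjE)
    obtain N' where N': "open N'" "z \<in> N'" "\<forall>x\<in>N' \<inter> D. g x = c'"
      using z(3) unfolding lim_def by (elim exE conjE)
    have "(N \<inter> N') \<inter> D \<noteq> {}"
      using N(1,2) N'(1,2) by (intro dense[OF z(1)]) auto
    then obtain x where "x \<in> N \<inter> D" "x \<in> N' \<inter> D" by blast
    then show ?thesis using N(3) N'(3) by metis
  qed
  have h: "lim z (h z)" if "z \<in> K" for z
    unfolding h_def using ex[OF that] by (rule someI_ex)
  have "\<forall>z\<in>K. eventually (\<lambda>b. h z = h b) (at z within K)"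
  proof
    fix z assume z: "z \<in> K"
    obtain N where N: "open N" "z \<in> N" "\<forall>x\<in>N \<inter> D. g x = h z"
      using h[OF z] unfolding lim_def by (elim exE conjE)
    have "h z = h b" if b: "b \<in> N" "b \<in> K" for b
    proof -
      have "lim b (h z)" unfolding lim_def using N b(1) by blast
      then show ?thesis by (rule unique[OF b(2) _ h[OF b(2)]])
    qed
    then show "eventually (\<lambda>b. h z = h b) (at z within K)"
      unfolding eventually_at_topological using N(1,2) by (intro exI[of _ N]) auto
  qed
  then have "h x = h y"
    using xy by (intro connected_local_const[OF assms(1)]) auto
  moreover have "g z = h z" if "z \<in> K \<inter> D" for z
  proof -
    have "lim z (h z)" using h that by blast
    then obtain N where "z \<in> N" "\<forall>x\<in>N \<inter> D. g x = h z"
      unfolding lim_def by (elim exE conjE)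
    then show ?thesis using that by (meson IntI IntD2)
  qed
  ultimately show ?thesis using xy by simp
qed

section \<open>Splines on line arrangements\<close>

text \<open>Distinctness of lines is put as sharing at most one point, which does not depend on how
  \<open>n\<close> and \<open>k\<close> are scaled and admits parallel lines.\<close>

locale line_arrangement =
  fixes U :: "(real^2) set" and I :: "'i set" and n :: "'i \<Rightarrow> real^2" and k :: "'i \<Rightarrow> real"
  assumes open_U: "open U" and convex_U: "convex U" and finite_I: "finite I"
    and n_nonzero: "i \<in> I \<Longrightarrow> n i \<noteq> 0"
    and lines_distinct: "i \<in> I \<Longrightarrow> j \<in> I \<Longrightarrow> i \<noteq> j \<Longrightarrow> n i \<bullet> x = k i \<Longrightarrow> n j \<bullet> x = k j
      \<Longrightarrow> n i \<bullet> y = k i \<Longrightarrow> n j \<bullet> y = k j \<Longrightarrow> x = y"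
begin

definition lam :: "'i \<Rightarrow> real^2 \<Rightarrow> real" where "lam i x = n i \<bullet> x - k i"

definition regular :: "(real^2) set" where "regular = {x \<in> U. \<forall>i\<in>I. lam i x \<noteq> 0}"

definition vertices :: "(real^2) set" where
  "vertices = {x \<in> U. \<exists>i\<in>I. \<exists>j\<in>I. i \<noteq> j \<and> lam i x = 0 \<and> lam j x = 0}"

text \<open>Heaviside step: for positive \<open>d\<close> the product of \<open>side i x\<close> and
  \<open>lam i x ^ d\<close> is the truncated power, and a difference of sides is a signed crossing
  of the line.\<close>

definition side :: "'i \<Rightarrow> real^2 \<Rightarrow> real" where "side i x = (if lam i x > 0 then 1 else 0)"

lemma lam_add: "lam i (x + t *\<^sub>R w) = lam i x + t * (n i \<bullet> w)"
  by (simp add: lam_def inner_add_right)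

lemma lam_eq_0_unique:
  assumes "i \<in> I" "j \<in> I" "i \<noteq> j" "lam i x = 0" "lam j x = 0" "lam i y = 0" "lam j y = 0"
  shows "x = y"
  using lines_distinct[OF assms(1-3), of x y] assms(4-) by (simp add: lam_def)

lemma finite_vertices: "finite vertices"
proof -
  have "finite {x. lam i x = 0 \<and> lam j x = 0}" if ij: "i \<in> I" "j \<in> I - {i}" for i j
  proof (cases "\<exists>x. lam i x = 0 \<and> lam j x = 0")
    case True
    then obtain x where x: "lam i x = 0" "lam j x = 0" by blast
    have "{x. lam i x = 0 \<and> lam j x = 0} \<subseteq> {x}"
      using lam_eq_0_unique[of i j _ x] x ij by blast
    then show ?thesis using finite_subset by blast
  next
    case False
    then have "{x. lam i x = 0 \<and> lam j x = 0} = {}" by blast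
    then show ?thesis by (simp only: finite.emptyI)
  qed
  then have "finite (\<Union>i\<in>I. \<Union>j\<in>I - {i}. {x. lam i x = 0 \<and> lam j x = 0})"
    using finite_I by (intro finite_UN_I) auto
  moreover have "vertices \<subseteq> (\<Union>i\<in>I. \<Union>j\<in>I - {i}. {x. lam i x = 0 \<and> lam j x = 0})"
    by (auto simp: vertices_def)
  ultimately show ?thesis using finite_subset by blast
qed

text \<open>Near \<open>z\<close> only lines through \<open>z\<close> can change sign; the others
  are finitely many and keep theirs on a common ball.\<close>

lemma sign_nbhd:
  assumes "z \<in> U" "open N" "z \<in> N"
  shows "\<exists>e>0. ball z e \<subseteq> U \<inter> N \<and>
    (\<forall>i\<in>I. lam i z \<noteq> 0 \<longrightarrow> (\<forall>x\<in>ball z e. sgn (lam i x) = sgn (lam i z)))"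
proof -
  let ?S = "(U \<inter> N) \<inter> (\<Inter>i\<in>{i \<in> I. lam i z \<noteq> 0}. {x. 0 < lam i x * lam i z})"
  have "open {x. 0 < lam i x * lam i z}" for i
    unfolding lam_def by (intro open_Collect_less continuous_intros)
  then have "open ?S"
    using open_U assms(2) finite_I by (intro open_Int open_INT) auto
  moreover have "z \<in> ?S"
    using assms by (auto simp: zero_less_mult_iff)
  ultimately obtain e where e: "e > 0" "ball z e \<subseteq> ?S"
    by (meson open_contains_ball)
  have "sgn (lam i x) = sgn (lam i z)" if "i \<in> I" "lam i z \<noteq> 0" "x \<in> ball z e" for i x
  proof -
    have "0 < lam i x * lam i z" using e(2) that by blast
    then show ?thesis by (auto simp: zero_less_mult_iff)
  qed
  moreover have "ball z e \<subseteq> U \<inter> N" using e(2) by blast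
  ultimately show ?thesis using e(1) by meson
qed

lemma regular_near:
  assumes w: "\<forall>i\<in>I. n i \<bullet> w \<noteq> 0" and "z \<in> U" "open N" "z \<in> N"
  shows "\<exists>e>0. \<forall>t. t \<noteq> 0 \<longrightarrow> \<bar>t\<bar> < e \<longrightarrow> z + t *\<^sub>R w \<in> N \<inter> regular"
proof -
  obtain e where e: "e > 0" "ball z e \<subseteq> U \<inter> N"
    "\<forall>i\<in>I. lam i z \<noteq> 0 \<longrightarrow> (\<forall>x\<in>ball z e. sgn (lam i x) = sgn (lam i z))"
    using sign_nbhd[OF assms(2-4)] by (elim exE conjE)
  show ?thesis
  proof (intro exI conjI allI impI)
    \<comment> \<open>The added 1 covers \<open>w = 0\<close>, which is possible when there are no
      lines.\<close>
    show "e / (norm w + 1) > 0" using e(1) by (simp add: add_nonneg_pos)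
    fix t assume t: "t \<noteq> 0" "\<bar>t\<bar> < e / (norm w + 1)"
    have "norm w + 1 > 0" by (simp add: add_nonneg_pos)
    then have "\<bar>t\<bar> * (norm w + 1) < e" using t(2) by (simp add: pos_less_divide_eq)
    then have "\<bar>t\<bar> * norm w < e" by (simp add: distrib_left)
    then have ball: "z + t *\<^sub>R w \<in> ball z e" by (simp add: dist_norm)
    moreover have "lam i (z + t *\<^sub>R w) \<noteq> 0" if "i \<in> I" for i
    proof (cases "lam i z = 0")
      case True
      then show ?thesis using w that t(1) by (simp add: lam_add)
    next
      case False
      then show ?thesis using e(3) that False ball by (metis sgn_0_0)
    qed
    ultimately show "z + t *\<^sub>R w \<in> N \<inter> regular"
      using e(2) by (auto simp: regular_def)
  qed
qed

lemma exists_generic_direction: "\<exists>w. \<forall>i\<in>I. n i \<bullet> w \<noteq> 0"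
  by (rule generic_direction[OF finite_I n_nonzero])

lemma both_sides:
  assumes "z \<in> U" "open N" "z \<in> N" "i \<in> I" "lam i z = 0"
  obtains x y where "x \<in> N \<inter> regular" "y \<in> N \<inter> regular" "lam i x > 0" "lam i y < 0"
proof -
  obtain w where w: "\<forall>i\<in>I. n i \<bullet> w \<noteq> 0" using exists_generic_direction by blast
  obtain e where e: "e > 0" "\<forall>t. t \<noteq> 0 \<longrightarrow> \<bar>t\<bar> < e \<longrightarrow> z + t *\<^sub>R w \<in> N \<inter> regular"
    using regular_near[OF w assms(1-3)] by (elim exE conjE)
  \<comment> \<open>The sign is chosen so that the step \<open>t\<close> leads to the positive side
    of line \<open>i\<close> and \<open>- t\<close> to the negative one.\<close>
  define t where "t = sgn (n i \<bullet> w) * (e / 2)"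
  have nz: "n i \<bullet> w \<noteq> 0" using w assms(4) by blast
  then have t: "t \<noteq> 0" "\<bar>t\<bar> < e"
    using e(1) by (auto simp: t_def abs_mult sgn_if)
  have "t * (n i \<bullet> w) = \<bar>n i \<bullet> w\<bar> * (e / 2)" by (simp add: t_def abs_sgn)
  moreover have "\<bar>n i \<bullet> w\<bar> * (e / 2) > 0" using nz e(1) by simp
  ultimately have t': "t * (n i \<bullet> w) > 0" by (simp only:)
  show thesis
  proof
    show "z + t *\<^sub>R w \<in> N \<inter> regular" "z + (- t) *\<^sub>R w \<in> N \<inter> regular"
      using e(2)[rule_format, of t] e(2)[rule_format, of "- t"] t by auto
    show "lam i (z + t *\<^sub>R w) > 0" "lam i (z + (- t) *\<^sub>R w) < 0"
      using t' unfolding lam_add assms(5) by auto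
  qed
qed

lemma regular_dense:
  assumes "z \<in> U" "open N" "z \<in> N"
  shows "N \<inter> regular \<noteq> {}"
proof -
  obtain w where w: "\<forall>i\<in>I. n i \<bullet> w \<noteq> 0" using exists_generic_direction by blast
  obtain e where e: "e > 0" "\<forall>t. t \<noteq> 0 \<longrightarrow> \<bar>t\<bar> < e \<longrightarrow> z + t *\<^sub>R w \<in> N \<inter> regular"
    using regular_near[OF w assms] by (elim exE conjE)
  then have "z + (e / 2) *\<^sub>R w \<in> N \<inter> regular" by auto
  then show ?thesis by blast
qed

text \<open>Any neighbourhood contains infinitely many points of the line, but there are finitely
  many vertices.\<close>

lemma nonvertex_dense_on_line:
  assumes "z \<in> U" "open N" "z \<in> N" "i \<in> I" "lam i z = 0"
  obtains x where "x \<in> N" "x \<in> U" "lam i x = 0" "x \<notin> vertices"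
proof -
  have "open ((\<lambda>t. z + t *\<^sub>R perp (n i)) -` (N \<inter> U))"
    by (intro open_vimage open_Int assms(2) open_U continuous_intros)
  moreover have "0 \<in> (\<lambda>t. z + t *\<^sub>R perp (n i)) -` (N \<inter> U)" using assms by simp
  ultimately obtain e where e: "e > 0" "ball 0 e \<subseteq> (\<lambda>t. z + t *\<^sub>R perp (n i)) -` (N \<inter> U)"
    by (meson open_contains_ball)
  have "infinite (ball (0::real) e)" using e(1) by (simp add: ball_eq_greaterThanLessThan)
  moreover have "inj_on (\<lambda>t. z + t *\<^sub>R perp (n i)) (ball 0 e)"
    using n_nonzero[OF assms(4)] by (auto intro!: inj_onI)
  ultimately have "infinite ((\<lambda>t. z + t *\<^sub>R perp (n i)) ` ball 0 e)"
    by (simp add: finite_image_iff)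
  then obtain x where x: "x \<in> (\<lambda>t. z + t *\<^sub>R perp (n i)) ` ball 0 e" "x \<notin> vertices"
    using finite_vertices by (meson finite_subset subsetI)
  then show thesis
    using e(2) by (intro that[of x]) (auto simp: lam_add assms(5) inner_perp)
qed

text \<open>Sign vectors in place of connected components make convexity immediate; for the triangle
  it is enough that each cell lies in some polygon of the split.\<close>

definition cell :: "real^2 \<Rightarrow> (real^2) set" where
  "cell x = {y \<in> U. \<forall>i\<in>I. sgn (lam i y) = sgn (lam i x)}"

lemma cell_subset_regular: "x \<in> regular \<Longrightarrow> cell x \<subseteq> regular"
  unfolding cell_def regular_def by (auto simp: sgn_0_0)

lemma convex_cell:
  assumes "x \<in> regular"
  shows "convex (cell x)"
proof -
  have "convex {y. sgn (lam i y) = sgn (lam i x)}" if "i \<in> I" for i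
  proof (cases "lam i x > 0")
    case True
    then have "{y. sgn (lam i y) = sgn (lam i x)} = {y. n i \<bullet> y > k i}"
      by (auto simp: lam_def sgn_if split: if_splits)
    then show ?thesis by (simp add: convex_halfspace_gt)
  next
    case False
    then have "lam i x < 0" using assms that by (auto simp: regular_def not_less le_less)
    then have "{y. sgn (lam i y) = sgn (lam i x)} = {y. n i \<bullet> y < k i}"
      by (auto simp: lam_def sgn_if split: if_splits)
    then show ?thesis by (simp add: convex_halfspace_lt)
  qed
  then have "convex (U \<inter> (\<Inter>i\<in>I. {y. sgn (lam i y) = sgn (lam i x)}))"
    by (intro convex_Int convex_U convex_INT) auto
  moreover have "cell x = U \<inter> (\<Inter>i\<in>I. {y. sgn (lam i y) = sgn (lam i x)})"
    by (auto simp: cell_def)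
  ultimately show ?thesis by simp
qed

text \<open>Near a point of line \<open>i\<close> that is no vertex all other truncated powers are
  polynomials. Together with \<open>p\<close> they vanish on the negative side, hence everywhere,
  and the positive side leaves \<open>c i\<close> times a nonzero power.\<close>

lemma trunc_powers_independent:
  assumes p: "bipoly_deg_le d p" and "d > 0"
    and zero: "\<And>x. x \<in> U \<Longrightarrow> p x + (\<Sum>i\<in>I. c i * max 0 (lam i x) ^ d) = 0"
    and i: "i \<in> I" and z: "z \<in> U" "lam i z = 0"
  shows "c i = 0"
proof -
  obtain v where v: "v \<in> U" "lam i v = 0" "v \<notin> vertices"
    by (rule nonvertex_dense_on_line[OF z(1) open_UNIV UNIV_I i z(2)])
  obtain e where e: "e > 0" "ball v e \<subseteq> U \<inter> UNIV"
    "\<forall>i\<in>I. lam i v \<noteq> 0 \<longrightarrow> (\<forall>x\<in>ball v e. sgn (lam i x) = sgn (lam i v))"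
    using sign_nbhd[OF v(1) open_UNIV UNIV_I] by (elim exE conjE)
  define q where "q x = p x + (\<Sum>j\<in>I - {i}. (c j * side j v) * lam j x ^ d)" for x
  have "bipoly_deg_le d (\<lambda>u. lam j u ^ d)" for j
    using bipoly_power[OF bipoly_affine[of "n j" "k j"], of d] by (simp add: lam_def)
  then have q: "bipoly_deg_le d q"
    unfolding q_def by (intro bipoly_add p bipoly_sum bipoly_cmul)
  have q_ball: "q x + c i * max 0 (lam i x) ^ d = 0" if x: "x \<in> ball v e" for x
  proof -
    have "c j * max 0 (lam j x) ^ d = (c j * side j v) * lam j x ^ d" if j: "j \<in> I - {i}" for j
    proof -
      have "lam j v \<noteq> 0" using v i j by (auto simp: vertices_def)
      then have "sgn (lam j x) = sgn (lam j v)" using e(3) j x by blast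
      then show ?thesis using \<open>d > 0\<close> by (auto simp: side_def sgn_if max_def split: if_splits)
    qed
    then have "(\<Sum>j\<in>I - {i}. c j * max 0 (lam j x) ^ d) = (\<Sum>j\<in>I - {i}. (c j * side j v) * lam j x ^ d)"
      by (intro sum.cong refl)
    moreover have "p x + (\<Sum>j\<in>I. c j * max 0 (lam j x) ^ d) = 0" using x e(2) zero by blast
    ultimately show ?thesis
      unfolding q_def by (subst (asm) sum.remove[OF finite_I i]) simp_all
  qed
  obtain a b where ab: "a \<in> ball v e \<inter> regular" "b \<in> ball v e \<inter> regular" "lam i a > 0" "lam i b < 0"
    by (rule both_sides[OF v(1) open_ball _ i v(2), of v e]) (use e(1) in auto)
  have "q a = 0"
  proof (rule bipoly_eq_0_if_open[OF q])
    show "open (ball v e \<inter> {x. n i \<bullet> x < k i})" by (intro open_Int open_ball open_halfspace_lt)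
    show "b \<in> ball v e \<inter> {x. n i \<bullet> x < k i}" using ab by (simp add: lam_def)
    show "q x = 0" if "x \<in> ball v e \<inter> {x. n i \<bullet> x < k i}" for x
      using q_ball[of x] that \<open>d > 0\<close> by (simp add: lam_def max_def zero_power)
  qed
  then show ?thesis using q_ball[of a] ab by simp
qed

end

section \<open>Jumps of a spline along the lines of an arrangement\<close>

locale arrangement_spline = line_arrangement U I n k
  for U :: "(real^2) set" and I :: "'i set" and n k +
  fixes d :: nat and f :: "real^2 \<Rightarrow> real"
  assumes d_pos: "d > 0" and smooth: "Ck_on (d - 1) U f"
    and pieces: "x \<in> regular \<Longrightarrow> \<exists>p. bipoly_deg_le d p \<and> (\<forall>y\<in>cell x. f y = p y)"
    and multiplicity: "v \<in> U \<Longrightarrow> card {i \<in> I. lam i v = 0} \<le> d + 1"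
begin

text \<open>The choice depends on \<open>x\<close> only through \<open>cell x\<close>, so equal sign
  vectors give literally the same function.\<close>

definition piece :: "real^2 \<Rightarrow> real^2 \<Rightarrow> real" where
  "piece x = (SOME p. bipoly_deg_le d p \<and> (\<forall>y\<in>cell x. f y = p y))"

lemma piece:
  assumes "x \<in> regular"
  shows "bipoly_deg_le d (piece x)" "y \<in> cell x \<Longrightarrow> f y = piece x y"
  using someI_ex[OF pieces[OF assms]] unfolding piece_def by auto

lemma piece_self: "x \<in> regular \<Longrightarrow> f x = piece x x"
  by (rule piece) (auto simp: cell_def regular_def)

lemma piece_cong:
  assumes "\<And>i. i \<in> I \<Longrightarrow> sgn (lam i x) = sgn (lam i y)"
  shows "piece x = piece y"
proof -
  have "cell x = cell y" using assms by (auto simp: cell_def)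
  then show ?thesis by (simp add: piece_def)
qed

text \<open>The difference of sides is 1, -1 or 0, so one equation covers both directions of
  crossing and the case of no crossing; \<open>u\<close> ranges over the whole plane, since
  polynomials are compared.\<close>

definition jump :: "'i \<Rightarrow> real^2 \<Rightarrow> real \<Rightarrow> bool" where
  "jump i z c \<longleftrightarrow> (\<exists>N. open N \<and> z \<in> N \<and> (\<forall>x\<in>N \<inter> regular. \<forall>y\<in>N \<inter> regular. \<forall>u.
      piece y u - piece x u = c * (side i y - side i x) * lam i u ^ d))"

text \<open>Off the vertices \<open>i\<close> is the only line through \<open>z\<close>, so on a
  small ball the sign of \<open>lam i\<close> alone decides the cell and just two polynomials
  meet.\<close>

lemma jump_exists:
  assumes i: "i \<in> I" and z: "z \<in> U" "z \<notin> vertices" "lam i z = 0"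
  shows "\<exists>c. jump i z c"
proof -
  obtain e where e: "e > 0" "ball z e \<subseteq> U \<inter> UNIV"
    "\<forall>i\<in>I. lam i z \<noteq> 0 \<longrightarrow> (\<forall>x\<in>ball z e. sgn (lam i x) = sgn (lam i z))"
    using sign_nbhd[OF z(1) open_UNIV UNIV_I] by (elim exE conjE)
  obtain p q where pq: "p \<in> ball z e \<inter> regular" "q \<in> ball z e \<inter> regular" "lam i p > 0" "lam i q < 0"
    using both_sides[OF z(1) open_ball _ i z(3), of z e] e(1) by auto
  have sgn_eq: "sgn (lam j x) = sgn (lam j y)"
    if "x \<in> ball z e" "y \<in> ball z e" "sgn (lam i x) = sgn (lam i y)" "j \<in> I" for x y j
  proof (cases "j = i")
    case False
    then have "lam j z \<noteq> 0" using z i that(4) by (auto simp: vertices_def)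
    then show ?thesis using e(3) that by simp
  qed (use that in simp)
  have pos: "piece x = piece p" if "x \<in> ball z e" "lam i x > 0" for x
    by (rule piece_cong, rule sgn_eq) (use that pq in auto)
  have neg: "piece x = piece q" if "x \<in> ball z e" "lam i x < 0" for x
    by (rule piece_cong, rule sgn_eq) (use that pq in auto)
  have fp: "f x = piece p x" if "x \<in> ball z e" "n i \<bullet> x > k i" for x
  proof (rule piece)
    have "sgn (lam j x) = sgn (lam j p)" if "j \<in> I" for j
      by (rule sgn_eq) (use that pq \<open>x \<in> ball z e\<close> \<open>n i \<bullet> x > k i\<close> in \<open>auto simp: lam_def\<close>)
    then show "x \<in> cell p" using that e(2) by (auto simp: cell_def)
  qed (use pq in auto)
  have fq: "f x = piece q x" if "x \<in> ball z e" "n i \<bullet> x < k i" for x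
  proof (rule piece)
    have "sgn (lam j x) = sgn (lam j q)" if "j \<in> I" for j
      by (rule sgn_eq) (use that pq \<open>x \<in> ball z e\<close> \<open>n i \<bullet> x < k i\<close> in \<open>auto simp: lam_def\<close>)
    then show "x \<in> cell q" using that e(2) by (auto simp: cell_def)
  qed (use pq in auto)
  have "Ck_on (d - 1) (ball z e) f"
    using Ck_on_subset[OF smooth] e(2) by auto
  then obtain c where c: "\<forall>u. piece p u - piece q u = c * (n i \<bullet> u - k i) ^ d"
    using jump_eq_power[OF open_ball _ _ _ n_nonzero[OF i], of d z e f "piece p" "piece q" z "k i"]
      fp fq piece(1) pq z(3) e(1) by (auto simp: lam_def)
  have "piece y u - piece x u = c * (side i y - side i x) * lam i u ^ d"
    if "x \<in> ball z e \<inter> regular" "y \<in> ball z e \<inter> regular" for x y u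
  proof -
    have cu: "piece p u - piece q u = c * lam i u ^ d" using c by (simp add: lam_def)
    have "lam i x \<noteq> 0" "lam i y \<noteq> 0" using that i by (auto simp: regular_def)
    then consider "lam i x > 0" "lam i y > 0" | "lam i x > 0" "lam i y < 0"
      | "lam i x < 0" "lam i y > 0" | "lam i x < 0" "lam i y < 0" by linarith
    then show ?thesis
    proof cases
      case 2
      then have "piece y u - piece x u = - (piece p u - piece q u)"
        using that pos[of x] neg[of y] by simp
      then show ?thesis using 2 cu by (simp add: side_def)
    qed (use that pos[of x] pos[of y] neg[of x] neg[of y] cu in \<open>simp_all add: side_def\<close>)
  qed
  then have "jump i z c"
    unfolding jump_def using e(1) by (intro exI[of _ "ball z e"]) auto
  then show ?thesis ..
qed

lemma jump_unique:
  assumes i: "i \<in> I" and z: "z \<in> U" "lam i z = 0" and "jump i z c" "jump i z c'"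
  shows "c = c'"
proof -
  obtain N where N: "open N" "z \<in> N" "\<forall>x\<in>N \<inter> regular. \<forall>y\<in>N \<inter> regular. \<forall>u.
      piece y u - piece x u = c * (side i y - side i x) * lam i u ^ d"
    using assms(4) unfolding jump_def by (elim exE conjE)
  obtain N' where N': "open N'" "z \<in> N'" "\<forall>x\<in>N' \<inter> regular. \<forall>y\<in>N' \<inter> regular. \<forall>u.
      piece y u - piece x u = c' * (side i y - side i x) * lam i u ^ d"
    using assms(5) unfolding jump_def by (elim exE conjE)
  obtain x y where xy: "x \<in> (N \<inter> N') \<inter> regular" "y \<in> (N \<inter> N') \<inter> regular" "lam i x > 0" "lam i y < 0"
    using both_sides[OF z(1) open_Int[OF N(1) N'(1)] _ i z(2)] N(2) N'(2) by blast
  have "piece y x - piece x x = c * (side i y - side i x) * lam i x ^ d"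
    "piece y x - piece x x = c' * (side i y - side i x) * lam i x ^ d"
    using N(3) N'(3) xy by blast+
  then show ?thesis using xy by (simp add: side_def)
qed

text \<open>Total by \<open>THE\<close>, but meaningful only at points of line \<open>i\<close>
  inside \<open>U\<close> that are no vertices; this is why vertices are excluded below.\<close>

definition jump_coeff :: "'i \<Rightarrow> real^2 \<Rightarrow> real" where "jump_coeff i z = (THE c. jump i z c)"

lemma jump_coeffI:
  assumes "i \<in> I" "z \<in> U" "lam i z = 0" "jump i z c"
  shows "jump_coeff i z = c"
  unfolding jump_coeff_def using assms jump_unique by blast

lemma jump_jump_coeff:
  assumes "i \<in> I" "z \<in> U" "z \<notin> vertices" "lam i z = 0"
  shows "jump i z (jump_coeff i z)"
  using jump_exists[OF assms] jump_coeffI[OF assms(1,2,4)] by metis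

text \<open>A neighbourhood that witnesses the jump at \<open>z\<close> witnesses it at each of its
  points.\<close>

lemma jump_coeff_locally_const:
  assumes "i \<in> I" "z \<in> U" "z \<notin> vertices" "lam i z = 0"
  shows "\<exists>N. open N \<and> z \<in> N \<and> (\<forall>x\<in>N \<inter> U. lam i x = 0 \<longrightarrow> jump_coeff i x = jump_coeff i z)"
proof -
  obtain N where N: "open N" "z \<in> N" "\<forall>x\<in>N \<inter> regular. \<forall>y\<in>N \<inter> regular. \<forall>u.
      piece y u - piece x u = jump_coeff i z * (side i y - side i x) * lam i u ^ d"
    using jump_jump_coeff[OF assms] unfolding jump_def by (elim exE conjE)
  then have "jump i x (jump_coeff i z)" if "x \<in> N" for x
    unfolding jump_def using that by (intro exI[of _ N]) simp
  then show ?thesis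
    using N(1,2) jump_coeffI[OF assms(1)] by (intro exI[of _ N]) auto
qed

lemma jump_coeff_const_on_connected:
  assumes i: "i \<in> I" and K: "connected K" "\<And>x. x \<in> K \<Longrightarrow> x \<in> U \<and> x \<notin> vertices \<and> lam i x = 0"
    and "x \<in> K" "y \<in> K"
  shows "jump_coeff i x = jump_coeff i y"
proof (rule connected_dense_locally_const[OF K(1), where D = K])
  fix z assume z: "z \<in> K"
  then have z': "z \<in> U" "z \<notin> vertices" "lam i z = 0" using K(2) by auto
  obtain N where "open N" "z \<in> N"
    "\<forall>x\<in>N \<inter> U. lam i x = 0 \<longrightarrow> jump_coeff i x = jump_coeff i z"
    using jump_coeff_locally_const[OF i z'] by (elim exE conjE)
  then show "\<exists>N. open N \<and> z \<in> N \<and> (\<forall>x\<in>N \<inter> K. \<forall>y\<in>N \<inter> K. jump_coeff i x = jump_coeff i y)"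
    using K(2) by (intro exI[of _ N]) (metis IntE IntI)
qed (use assms in auto)

text \<open>Off the vertices, subtracting the jumps makes the polynomial pieces locally constant.\<close>

lemma pieces_differ_by_jumps:
  assumes K: "connected K" "K \<subseteq> U - vertices"
    and c: "\<And>i z. i \<in> I \<Longrightarrow> z \<in> K \<Longrightarrow> lam i z = 0 \<Longrightarrow> jump_coeff i z = c i"
    and xy: "x \<in> K \<inter> regular" "y \<in> K \<inter> regular"
  shows "piece y u - piece x u = (\<Sum>i\<in>I. c i * (side i y - side i x) * lam i u ^ d)"
proof -
  \<comment> \<open>The values of \<open>g\<close> are functions of \<open>u\<close>, so local
    constancy compares whole polynomials and not values at one point.\<close>
  define g where "g = (\<lambda>x u. piece x u - (\<Sum>i\<in>I. c i * side i x * lam i u ^ d))"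
  have g_diff: "g y u - g x u = (piece y u - piece x u) - (\<Sum>i\<in>I. c i * (side i y - side i x) * lam i u ^ d)"
    for x y u
    by (simp add: g_def sum_subtractf algebra_simps)
  have "g x = g y"
  proof (rule connected_dense_locally_const[OF K(1) _ _ xy])
    fix z N assume "z \<in> K" "open N" "z \<in> N"
    then show "N \<inter> regular \<noteq> {}" using regular_dense K(2) by blast
  next
    fix z assume "z \<in> K"
    then have z: "z \<in> U" "z \<notin> vertices" using K(2) by auto
    show "\<exists>N. open N \<and> z \<in> N \<and> (\<forall>x\<in>N \<inter> regular. \<forall>y\<in>N \<inter> regular. g x = g y)"
    proof (cases "\<exists>i\<in>I. lam i z = 0")
      case False
      obtain e where e: "e > 0" "ball z e \<subseteq> U \<inter> UNIV"
        "\<forall>i\<in>I. lam i z \<noteq> 0 \<longrightarrow> (\<forall>x\<in>ball z e. sgn (lam i x) = sgn (lam i z))"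
        using sign_nbhd[OF z(1) open_UNIV UNIV_I] by (elim exE conjE)
      have sgn: "sgn (lam i x) = sgn (lam i z)" if "x \<in> ball z e" "i \<in> I" for x i
        using that e(3) False by blast
      have "g x = g z" if "x \<in> ball z e" for x
      proof -
        have "piece x = piece z" using sgn[OF that] by (intro piece_cong) auto
        moreover have "side i x = side i z" if "i \<in> I" for i
          using sgn[OF \<open>x \<in> ball z e\<close> that] by (auto simp: side_def sgn_if split: if_splits)
        ultimately show ?thesis by (simp add: g_def)
      qed
      then have "\<forall>x\<in>ball z e \<inter> regular. \<forall>y\<in>ball z e \<inter> regular. g x = g y" by (metis IntD1)
      then show ?thesis using e(1) open_ball centre_in_ball by meson
    next
      \<comment> \<open>As \<open>z\<close> is no vertex, \<open>i\<close> is the only line through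
        it. The ball lies in the neighbourhood of the jump, and on it all other sides are
        fixed.\<close>
      case True
      then obtain i where i: "i \<in> I" "lam i z = 0" by blast
      obtain N where N: "open N" "z \<in> N" "\<forall>x\<in>N \<inter> regular. \<forall>y\<in>N \<inter> regular. \<forall>u.
          piece y u - piece x u = jump_coeff i z * (side i y - side i x) * lam i u ^ d"
        using jump_jump_coeff[OF i(1) z i(2)] unfolding jump_def by (elim exE conjE)
      obtain e where e: "e > 0" "ball z e \<subseteq> U \<inter> N"
        "\<forall>i\<in>I. lam i z \<noteq> 0 \<longrightarrow> (\<forall>x\<in>ball z e. sgn (lam i x) = sgn (lam i z))"
        using sign_nbhd[OF z(1) N(1,2)] by (elim exE conjE)
      have "g x = g y" if "x \<in> ball z e \<inter> regular" "y \<in> ball z e \<inter> regular" for x y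
      proof
        fix u
        have "side j x = side j y" if "j \<in> I - {i}" for j
        proof -
          have "lam j z \<noteq> 0" using i that z by (auto simp: vertices_def)
          then have "sgn (lam j x) = sgn (lam j y)"
            using e(3) that \<open>x \<in> ball z e \<inter> regular\<close> \<open>y \<in> ball z e \<inter> regular\<close> by auto
          then show ?thesis by (auto simp: side_def sgn_if split: if_splits)
        qed
        then have "(\<Sum>j\<in>I. c j * (side j y - side j x) * lam j u ^ d) = c i * (side i y - side i x) * lam i u ^ d"
          by (subst sum.remove[OF finite_I i(1)]) (simp add: sum.neutral)
        moreover have "piece y u - piece x u = jump_coeff i z * (side i y - side i x) * lam i u ^ d"
          using N(3) e(2) that by blast
        moreover have "jump_coeff i z = c i" using c i \<open>z \<in> K\<close> by blast
        ultimately have "g y u - g x u = 0" unfolding g_diff by simp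
        then show "g x u = g y u" by simp
      qed
      then have "\<forall>x\<in>ball z e \<inter> regular. \<forall>y\<in>ball z e \<inter> regular. g x = g y" by (intro ballI)
      then show ?thesis using e(1) open_ball centre_in_ball by meson
    qed
  qed
  then show ?thesis using g_diff[where x = x and y = y and u = u] by simp
qed

text \<open>A line through the middle of a disc around \<open>v\<close>, transversal to all lines of the arrangement,
  cuts it into two half discs on which every jump is constant. Going from one end of that line to the
  other through either half disc gives the same total jump, so the two systems of jumps
  agree because the at most \<open>d + 1\<close> powers \<open>lam i ^ d\<close> are linearly independent.\<close>

lemma jump_coeff_const_near_point:
  assumes i: "i \<in> I" and v: "v \<in> U" "lam i v = 0"
  shows "\<exists>N c. open N \<and> v \<in> N \<and> (\<forall>z\<in>N. z \<noteq> v \<longrightarrow> lam i z = 0 \<longrightarrow> jump_coeff i z = c)"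
proof -
  obtain e where e: "e > 0" "ball v e \<subseteq> U \<inter> UNIV"
    "\<forall>i\<in>I. lam i v \<noteq> 0 \<longrightarrow> (\<forall>x\<in>ball v e. sgn (lam i x) = sgn (lam i v))"
    using sign_nbhd[OF v(1) open_UNIV UNIV_I] by (elim exE conjE)
  have nonvertex: "z \<notin> vertices" if "z \<in> ball v e" "z \<noteq> v" for z
  proof
    assume "z \<in> vertices"
    then obtain j l where jl: "j \<in> I" "l \<in> I" "j \<noteq> l" "lam j z = 0" "lam l z = 0"
      by (auto simp: vertices_def)
    then have "lam j v = 0" "lam l v = 0"
      using e(3) that(1) by (metis sgn_0_0)+
    then show False using lam_eq_0_unique[of j l z v] jl that(2) by blast
  qed
  obtain w where w: "\<forall>i\<in>I. n i \<bullet> w \<noteq> 0" using exists_generic_direction by blast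
  then have w0: "w \<noteq> 0" using i by auto
  \<comment> \<open>The values 1 and -1 of \<open>s\<close> select the two open half discs cut off
    by the diameter in direction \<open>w\<close>.\<close>
  define H where "H s = ball v e \<inter> {x. (s *\<^sub>R perp w) \<bullet> x > (s *\<^sub>R perp w) \<bullet> v}" for s :: real
  have convex_H: "convex (H s)" for s
    unfolding H_def by (intro convex_Int convex_ball convex_halfspace_gt)
  have H_sub: "H s \<subseteq> U - vertices" for s
    using e(2) nonvertex by (fastforce simp: H_def)
  \<comment> \<open>The jump of line \<open>j\<close> in the half disc, read off at an arbitrary
    point. A line that misses the half disc gets a meaningless value, but it does not pass through
    \<open>v\<close>, so below that value is multiplied by a zero difference of sides.\<close>
  define cs where "cs s j = jump_coeff j (SOME z. z \<in> H s \<and> lam j z = 0)" for s j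
  have cs: "jump_coeff j z = cs s j" if "j \<in> I" "z \<in> H s" "lam j z = 0" for s j z
    unfolding cs_def
  proof (rule jump_coeff_const_on_connected[OF that(1), of "H s \<inter> {x. n j \<bullet> x = k j}"])
    show "connected (H s \<inter> {x. n j \<bullet> x = k j})"
      by (intro convex_connected convex_Int convex_H convex_hyperplane)
    have "\<exists>z. z \<in> H s \<and> lam j z = 0" using that by blast
    from someI_ex[OF this] show "(SOME z. z \<in> H s \<and> lam j z = 0) \<in> H s \<inter> {x. n j \<bullet> x = k j}"
      by (simp add: lam_def)
  qed (use that H_sub[of s] in \<open>auto simp: lam_def\<close>)
  \<comment> \<open>The end points \<open>x0\<close> and \<open>y0\<close> lie on the diameter, in
    neither half disc; a small shift along \<open>perp w\<close> enters the chosen one without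
    changing any sign.\<close>
  have push: "\<exists>x'\<in>H s \<inter> regular. \<forall>j\<in>I. sgn (lam j x') = sgn (lam j x)"
    if x: "x \<in> ball v e \<inter> regular" "perp w \<bullet> x = perp w \<bullet> v" and s: "s = 1 \<or> s = -1" for x s
  proof -
    have "x \<in> U" using x(1) by (simp add: regular_def)
    obtain r where r: "r > 0" "ball x r \<subseteq> U \<inter> ball v e"
      "\<forall>i\<in>I. lam i x \<noteq> 0 \<longrightarrow> (\<forall>y\<in>ball x r. sgn (lam i y) = sgn (lam i x))"
      using sign_nbhd[OF \<open>x \<in> U\<close> open_ball IntD1[OF x(1)]] by (elim exE conjE)
    define t where "t = r / (2 * norm (perp w))"
    have t: "t > 0" "t * norm (perp w) < r" using r(1) w0 by (auto simp: t_def)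
    let ?x = "x + (t * s) *\<^sub>R perp w"
    have "?x \<in> ball x r" using t s by (auto simp: dist_norm abs_mult)
    moreover from this have sgn: "sgn (lam j ?x) = sgn (lam j x)" if "j \<in> I" for j
      using r(3) that x(1) by (auto simp: regular_def)
    moreover have "lam j ?x \<noteq> 0" if "j \<in> I" for j
      using sgn[OF that] that x(1) by (auto simp: regular_def sgn_0_0)
    moreover have "(s *\<^sub>R perp w) \<bullet> ?x > (s *\<^sub>R perp w) \<bullet> v"
    proof -
      have "(s *\<^sub>R perp w) \<bullet> ?x - (s *\<^sub>R perp w) \<bullet> v = s * s * (t * (perp w \<bullet> perp w))"
        using x(2) by (simp add: inner_add_right algebra_simps)
      moreover have "t * (perp w \<bullet> perp w) > 0" using t(1) w0 by simp
      moreover have "s * s = 1" using s by auto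
      ultimately show ?thesis by simp
    qed
    ultimately have "?x \<in> H s \<inter> regular"
      using r(2) by (auto simp: H_def regular_def)
    then show ?thesis using sgn by blast
  qed
  obtain t where t: "t > 0" "\<forall>r. r \<noteq> 0 \<longrightarrow> \<bar>r\<bar> < t \<longrightarrow> v + r *\<^sub>R w \<in> ball v e \<inter> regular"
    using regular_near[OF w v(1) open_ball, of v e] e(1) by auto
  define x0 where "x0 = v + (t / 2) *\<^sub>R w"
  define y0 where "y0 = v + (- t / 2) *\<^sub>R w"
  have xy0: "x0 \<in> ball v e \<inter> regular" "y0 \<in> ball v e \<inter> regular"
    using t(2)[rule_format, of "t / 2"] t(2)[rule_format, of "- t / 2"] t(1)
    by (simp_all add: x0_def y0_def)
  have mid: "perp w \<bullet> x0 = perp w \<bullet> v" "perp w \<bullet> y0 = perp w \<bullet> v"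
    by (simp_all add: x0_def y0_def inner_add_right inner_diff_right inner_perp)
  have side_eq: "side j x = side j y" if "sgn (lam j x) = sgn (lam j y)" for j x y
    using that by (auto simp: side_def sgn_if split: if_splits)
  have total: "piece y0 u - piece x0 u = (\<Sum>j\<in>I. cs s j * (side j y0 - side j x0) * lam j u ^ d)"
    if s: "s = 1 \<or> s = -1" for s u
  proof -
    obtain x y where x: "x \<in> H s \<inter> regular" "\<forall>j\<in>I. sgn (lam j x) = sgn (lam j x0)"
      and y: "y \<in> H s \<inter> regular" "\<forall>j\<in>I. sgn (lam j y) = sgn (lam j y0)"
      using push[OF xy0(1) mid(1) s] push[OF xy0(2) mid(2) s] by blast
    have "piece y u - piece x u = (\<Sum>j\<in>I. cs s j * (side j y - side j x) * lam j u ^ d)"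
      using cs by (intro pieces_differ_by_jumps[OF convex_connected[OF convex_H] H_sub _ x(1) y(1)])
    moreover have "piece x = piece x0" "piece y = piece y0"
      using x(2) y(2) by (auto intro: piece_cong)
    moreover have "(\<Sum>j\<in>I. cs s j * (side j y - side j x) * lam j u ^ d)
        = (\<Sum>j\<in>I. cs s j * (side j y0 - side j x0) * lam j u ^ d)"
      using side_eq x(2) y(2) by (intro sum.cong refl) metis
    ultimately show ?thesis by simp
  qed
  define J where "J = {j \<in> I. lam j v = 0}"
  \<comment> \<open>The two expressions for the same total jump, subtracted line by line.\<close>
  define a where "a j = (cs 1 j - cs (-1) j) * (side j y0 - side j x0)" for j
  have "a i = 0"
  proof (rule powers_independent[of J d n w])
    show "finite J" "card J \<le> d + 1" "i \<in> J"
      using finite_I multiplicity[OF v(1)] i v(2) by (auto simp: J_def)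
    show "n j \<bullet> w \<noteq> 0" if "j \<in> J" for j using w that by (simp add: J_def)
    show "x = 0" if "j \<in> J" "l \<in> J" "j \<noteq> l" "n j \<bullet> x = 0" "n l \<bullet> x = 0" for j l x
    proof -
      have "v + 1 *\<^sub>R x = v"
        by (rule lam_eq_0_unique[of j l]) (use that in \<open>auto simp: J_def lam_def inner_add_right\<close>)
      then show ?thesis by simp
    qed
    fix x
    \<comment> \<open>For lines through \<open>v\<close>, \<open>lam j (v + x)\<close> equals the
      form \<open>n j\<close> at \<open>x\<close>; the other lines contribute 0, having
      \<open>x0\<close> and \<open>y0\<close> on the same side.\<close>
    have "(\<Sum>j\<in>J. a j * (n j \<bullet> x) ^ d) = (\<Sum>j\<in>J. a j * lam j (v + 1 *\<^sub>R x) ^ d)"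
      by (intro sum.cong refl) (simp add: J_def lam_add del: scaleR_one)
    also have "\<dots> = (\<Sum>j\<in>I. a j * lam j (v + 1 *\<^sub>R x) ^ d)"
    proof (rule sum.mono_neutral_left)
      show "\<forall>j\<in>I - J. a j * lam j (v + 1 *\<^sub>R x) ^ d = 0"
      proof
        fix j assume j: "j \<in> I - J"
        then have "sgn (lam j x0) = sgn (lam j v)" "sgn (lam j y0) = sgn (lam j v)"
          using e(3) xy0 by (auto simp: J_def)
        then have "side j x0 = side j y0" by (intro side_eq) simp
        then show "a j * lam j (v + 1 *\<^sub>R x) ^ d = 0" by (simp add: a_def)
      qed
    qed (auto simp: J_def finite_I)
    also have "\<dots> = (\<Sum>j\<in>I. cs 1 j * (side j y0 - side j x0) * lam j (v + 1 *\<^sub>R x) ^ d)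
        - (\<Sum>j\<in>I. cs (-1) j * (side j y0 - side j x0) * lam j (v + 1 *\<^sub>R x) ^ d)"
      unfolding sum_subtractf[symmetric] by (intro sum.cong refl) (simp add: a_def algebra_simps)
    also have "\<dots> = 0"
      using total[of 1 "v + 1 *\<^sub>R x"] total[of "-1" "v + 1 *\<^sub>R x"] by simp
    finally show "(\<Sum>j\<in>J. a j * (n j \<bullet> x) ^ d) = 0" .
  qed
  \<comment> \<open>Transversality puts \<open>x0\<close> and \<open>y0\<close> on opposite sides of
    line \<open>i\<close>, so \<open>a i = 0\<close> equates its two jumps.\<close>
  moreover have "side i y0 - side i x0 \<noteq> 0"
  proof -
    have "lam i x0 = t / 2 * (n i \<bullet> w)" "lam i y0 = - (t / 2 * (n i \<bullet> w))"
      unfolding x0_def y0_def lam_add v(2) by simp_all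
    moreover have "t / 2 * (n i \<bullet> w) \<noteq> 0" using w i t(1) by simp
    ultimately show ?thesis unfolding side_def by (simp only:) auto
  qed
  ultimately have cs_eq: "cs (-1) i = cs 1 i" by (simp add: a_def)
  have "jump_coeff i z = cs 1 i" if z: "z \<in> ball v e" "z \<noteq> v" "lam i z = 0" for z
  proof -
    \<comment> \<open>A point of line \<open>i\<close> on the diameter can only be \<open>v\<close>,
      because \<open>w\<close> is not parallel to the line.\<close>
    have "perp w \<bullet> (z - v) \<noteq> 0"
    proof
      assume "perp w \<bullet> (z - v) = 0"
      then have dec: "z - v = ((w \<bullet> (z - v)) / (w \<bullet> w)) *\<^sub>R w"
        using perp_decomposition[OF w0, of "z - v"] by simp
      have "n i \<bullet> (z - v) = 0" using z(3) v(2) by (simp add: lam_def inner_diff_right)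
      then have "(w \<bullet> (z - v)) / (w \<bullet> w) * (n i \<bullet> w) = 0"
        by (subst (asm) dec) (simp only: inner_scaleR_right)
      then have "(w \<bullet> (z - v)) / (w \<bullet> w) = 0" using w i by simp
      with dec have "z - v = 0" by (simp only: scaleR_zero_left)
      then show False using z(2) by simp
    qed
    then have "z \<in> H 1 \<or> z \<in> H (-1)"
      using z(1) by (auto simp: H_def inner_diff_right)
    then show ?thesis using cs[OF i _ z(3)] cs_eq by auto
  qed
  then show ?thesis
    using e(1) by (intro exI[of _ "ball v e"] exI[of _ "cs 1 i"]) auto
qed

text \<open>Connectedness is applied to the whole convex chord; the vertices are removed only from
  the dense set on which the coefficient is meaningful. At a vertex the preceding lemma supplies
  local constancy.\<close>

lemma jump_coeff_const:
  assumes i: "i \<in> I" and "x \<in> U - vertices" "lam i x = 0" "y \<in> U - vertices" "lam i y = 0"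
  shows "jump_coeff i x = jump_coeff i y"
proof -
  define K where "K = U \<inter> {x. n i \<bullet> x = k i}"
  have K: "z \<in> K \<longleftrightarrow> z \<in> U \<and> lam i z = 0" for z by (auto simp: K_def lam_def)
  show ?thesis
  proof (rule connected_dense_locally_const[of K "K - vertices"])
    show "connected K"
      unfolding K_def by (intro convex_connected convex_Int convex_U convex_hyperplane)
    show "N \<inter> (K - vertices) \<noteq> {}" if z: "z \<in> K" "open N" "z \<in> N" for z N
    proof -
      have "z \<in> U" "lam i z = 0" using z K by auto
      from nonvertex_dense_on_line[OF this(1) z(2,3) i this(2)]
      obtain x where "x \<in> N" "x \<in> U" "lam i x = 0" "x \<notin> vertices" .
      then show ?thesis using K by blast
    qed
    show "\<exists>N. open N \<and> z \<in> N \<and> (\<forall>x\<in>N \<inter> (K - vertices). \<forall>y\<in>N \<inter> (K - vertices). jump_coeff i x = jump_coeff i y)"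
      if "z \<in> K" for z
    proof (cases "z \<in> vertices")
      case True
      have z: "z \<in> U" "lam i z = 0" using that K by auto
      obtain N c where N: "open N" "z \<in> N" "\<forall>x\<in>N. x \<noteq> z \<longrightarrow> lam i x = 0 \<longrightarrow> jump_coeff i x = c"
        using jump_coeff_const_near_point[OF i z] by (elim exE conjE)
      then have "jump_coeff i x = c" if "x \<in> N \<inter> (K - vertices)" for x
        using that True K by auto
      then have "\<forall>x\<in>N \<inter> (K - vertices). \<forall>y\<in>N \<inter> (K - vertices). jump_coeff i x = jump_coeff i y"
        by metis
      then show ?thesis using N(1,2) by meson
    next
      case False
      have z: "z \<in> U" "lam i z = 0" using that K by auto
      obtain N where N: "open N" "z \<in> N"
        "\<forall>x\<in>N \<inter> U. lam i x = 0 \<longrightarrow> jump_coeff i x = jump_coeff i z"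
        using jump_coeff_locally_const[OF i z(1) False z(2)] by (elim exE conjE)
      then have "jump_coeff i x = jump_coeff i z" if "x \<in> N \<inter> (K - vertices)" for x
        using that K by auto
      then have "\<forall>x\<in>N \<inter> (K - vertices). \<forall>y\<in>N \<inter> (K - vertices). jump_coeff i x = jump_coeff i y"
        by metis
      then show ?thesis using N(1,2) by meson
    qed
  qed (use assms K in auto)
qed

text \<open>Jumps being constant along each line, every piece is compared at once with the piece of
  one reference point \<open>x0\<close>, inside \<open>U\<close> without its vertices, which is
  connected because the plane has dimension 2.\<close>

theorem representation:
  "\<exists>p c. bipoly_deg_le d p \<and> (\<forall>x\<in>U. f x = p x + (\<Sum>i\<in>I. c i * max 0 (lam i x) ^ d))"
proof (cases "U = {}")
  case False
  then obtain x0 where x0: "x0 \<in> regular" using regular_dense[OF _ open_UNIV UNIV_I] by blast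
  define c where "c i = jump_coeff i (SOME z. z \<in> U - vertices \<and> lam i z = 0)" for i
  have c: "jump_coeff i z = c i" if "i \<in> I" "z \<in> U - vertices" "lam i z = 0" for i z
  proof -
    have "\<exists>z. z \<in> U - vertices \<and> lam i z = 0" using that by blast
    from someI_ex[OF this] show ?thesis
      unfolding c_def using that by (intro jump_coeff_const[OF that(1)]) auto
  qed
  have con: "connected (U - vertices)"
    by (intro connected_open_delete_finite open_U convex_connected convex_U finite_vertices) simp
  \<comment> \<open>The reference piece minus the truncated powers that are active at
    \<open>x0\<close>.\<close>
  define p where "p u = piece x0 u - (\<Sum>i\<in>I. c i * side i x0 * lam i u ^ d)" for u
  have "bipoly_deg_le d p"
  proof -
    have "bipoly_deg_le d (\<lambda>u. lam i u ^ d)" for i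
      using bipoly_power[OF bipoly_affine[of "n i" "k i"], of d] by (simp add: lam_def)
    then show ?thesis
      unfolding p_def by (intro bipoly_diff piece(1) x0 bipoly_sum bipoly_cmul)
  qed
  moreover define g where "g x = p x + (\<Sum>i\<in>I. c i * max 0 (lam i x) ^ d)" for x
  have reg: "f y = g y" if y: "y \<in> regular" for y
  proof -
    have "x0 \<in> (U - vertices) \<inter> regular" "y \<in> (U - vertices) \<inter> regular"
      using x0 y by (auto simp: regular_def vertices_def)
    then have "piece y y - piece x0 y = (\<Sum>i\<in>I. c i * (side i y - side i x0) * lam i y ^ d)"
      using c by (intro pieces_differ_by_jumps[OF con order_refl])
    also have "\<dots> = (\<Sum>i\<in>I. c i * max 0 (lam i y) ^ d) - (\<Sum>i\<in>I. c i * side i x0 * lam i y ^ d)"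
      unfolding sum_subtractf[symmetric]
    proof (intro sum.cong refl)
      fix i assume "i \<in> I"
      have "side i y * lam i y ^ d = max 0 (lam i y) ^ d"
        using d_pos by (simp add: side_def max_def)
      then show "c i * (side i y - side i x0) * lam i y ^ d
          = c i * max 0 (lam i y) ^ d - c i * side i x0 * lam i y ^ d"
        by (metis (no_types) left_diff_distrib mult.assoc right_diff_distrib)
    qed
    finally show ?thesis using piece_self[OF y] by (simp add: g_def p_def)
  qed
  \<comment> \<open>Both sides are continuous and agree on the dense set of regular points.\<close>
  have "f y = g y" if y: "y \<in> U" for y
  proof (rule ccontr)
    assume neq: "f y \<noteq> g y"
    have "continuous_on U (\<lambda>x. f x - g x)"
      unfolding g_def lam_def
      by (intro continuous_intros Ck_on_continuous[OF smooth]
          Ck_on_continuous[OF Ck_on_bipoly[OF open_U \<open>bipoly_deg_le d p\<close>, of 0]])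
    then have "open (U \<inter> (\<lambda>x. f x - g x) -` (- {0}))"
      using open_U by (intro continuous_open_preimage) auto
    then have "(U \<inter> (\<lambda>x. f x - g x) -` (- {0})) \<inter> regular \<noteq> {}"
      using neq y by (intro regular_dense[of y]) auto
    then show False using reg by auto
  qed
  then show ?thesis unfolding g_def using \<open>bipoly_deg_le d p\<close> by blast
next
  case True
  then show ?thesis using bipoly_const[of d 0] by blast
qed

end

section \<open>Chords of a triangle\<close>

text \<open>In the plane all normals to \<open>v\<close> are multiples of \<open>perp v\<close>;
  hence two nonzero normals that annihilate a common nonzero vector have the same kernel.\<close>

lemma inner_eq_0_iff_perp:
  assumes "n \<noteq> 0" "v \<noteq> 0" "n \<bullet> v = 0"
  shows "n \<bullet> u = 0 \<longleftrightarrow> perp v \<bullet> u = 0"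
proof -
  define a where "a = (perp v \<bullet> n) / (v \<bullet> v)"
  have "n = a *\<^sub>R perp v"
    using perp_decomposition[OF assms(2), of n] assms(3) by (simp add: a_def inner_commute)
  moreover from this have "a \<noteq> 0" using assms(1) by auto
  ultimately show ?thesis by simp
qed

text \<open>For \<open>t > 1\<close> the point \<open>b\<close> would lie strictly between an
  interior point and a point of \<open>T\<close>, and so be interior.\<close>

lemma chord_bound:
  fixes a b :: "'a::euclidean_space"
  assumes "convex T" "a + r *\<^sub>R (b - a) \<in> interior T" "r \<le> 1" "b \<notin> interior T"
    and "a + t *\<^sub>R (b - a) \<in> T"
  shows "t \<le> 1"
proof (rule ccontr)
  assume "\<not> t \<le> 1"
  then have t: "t > 1" by simp
  \<comment> \<open>Chosen so that shrinking towards the interior point lands at parameter 1, that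
    is, at \<open>b\<close>.\<close>
  define e where "e = (t - 1) / (t - r)"
  have e: "0 < e" "e \<le> 1" using t assms(3) by (auto simp: e_def)
  have "(a + t *\<^sub>R (b - a)) - e *\<^sub>R ((a + t *\<^sub>R (b - a)) - (a + r *\<^sub>R (b - a))) \<in> interior T"
    using assms(5) closure_subset e
    by (intro mem_interior_closure_convex_shrink[OF assms(1,2)]) auto
  moreover have "(a + t *\<^sub>R (b - a)) - e *\<^sub>R ((a + t *\<^sub>R (b - a)) - (a + r *\<^sub>R (b - a)))
      = a + (t - e * (t - r)) *\<^sub>R (b - a)"
    by (simp add: algebra_simps)
  moreover have "e * (t - r) = t - 1" using t assms(3) by (simp add: e_def)
  ultimately show False using assms(4) by simp
qed

text \<open>A line through an interior point leaves \<open>T\<close> at its two boundary points;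
  this allows segments of the split to be treated as full lines.\<close>

lemma chord_eq_line_section:
  fixes a b :: "real^2"
  assumes T: "convex T" and ab: "a \<in> T" "b \<in> T" "a \<notin> interior T" "b \<notin> interior T"
    and meets: "closed_segment a b \<inter> interior T \<noteq> {}"
  shows "{x \<in> T. perp (b - a) \<bullet> x = perp (b - a) \<bullet> a} = closed_segment a b"
proof (intro equalityI subsetI)
  fix x assume "x \<in> closed_segment a b"
  then obtain u where u: "0 \<le> u" "u \<le> 1" "x = a + u *\<^sub>R (b - a)"
    by (auto simp: in_segment algebra_simps)
  have "x \<in> T" using \<open>x \<in> closed_segment a b\<close> T ab closed_segment_subset by blast
  then show "x \<in> {x \<in> T. perp (b - a) \<bullet> x = perp (b - a) \<bullet> a}"
    unfolding u(3) by (simp add: inner_add_right inner_perp)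
next
  fix x assume x: "x \<in> {x \<in> T. perp (b - a) \<bullet> x = perp (b - a) \<bullet> a}"
  obtain r where r: "0 \<le> r" "r \<le> 1" "a + r *\<^sub>R (b - a) \<in> interior T"
  proof -
    obtain y where y: "y \<in> closed_segment a b" "y \<in> interior T" using meets by blast
    then obtain r where "0 \<le> r" "r \<le> 1" "y = (1 - r) *\<^sub>R a + r *\<^sub>R b" by (auto simp: in_segment)
    moreover from this have "y = a + r *\<^sub>R (b - a)" by (simp add: algebra_simps)
    ultimately show ?thesis using y(2) that[of r] by (simp only:)
  qed
  have "b - a \<noteq> 0" using r(3) ab(3) by auto
  then obtain t where "x - a = t *\<^sub>R (b - a)"
    using perp_decomposition[of "b - a" "x - a"] x by (auto simp: inner_diff_right)
  then have t: "x = a + t *\<^sub>R (b - a)" by (simp add: algebra_simps)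
  have "t \<le> 1"
    using chord_bound[OF T r(3,2) ab(4)] x t by simp
  \<comment> \<open>The same bound from the other end, with \<open>a\<close> and \<open>b\<close>
    exchanged and parameters counted from \<open>b\<close>.\<close>
  moreover have "1 - t \<le> 1"
  proof (rule chord_bound[OF T _ _ ab(3)])
    show "b + (1 - r) *\<^sub>R (a - b) \<in> interior T" using r(3) by (simp add: algebra_simps)
    show "b + (1 - t) *\<^sub>R (a - b) \<in> T" using x t by (simp add: algebra_simps)
  qed (use r in auto)
  ultimately show "x \<in> closed_segment a b"
    unfolding t in_segment by (intro exI[of _ t]) (simp add: algebra_simps)
qed

lemma barycentric_unique:
  fixes p q r :: "real^2"
  assumes "\<not> collinear {p, q, r}" "x + y + z = 1" "x' + y' + z' = 1"
    and "x *\<^sub>R p + y *\<^sub>R q + z *\<^sub>R r = x' *\<^sub>R p + y' *\<^sub>R q + z' *\<^sub>R r"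
  shows "x = x' \<and> y = y' \<and> z = z'"
proof -
  have ne: "p \<noteq> q" "p \<noteq> r" "q \<noteq> r" and indep: "\<not> affine_dependent {p, q, r}"
    using assms(1) unfolding collinear_3_eq_affine_dependent by auto
  define u where "u = (\<lambda>v. if v = p then x - x' else if v = q then y - y' else z - z')"
  have "sum u {p, q, r} = 0" using ne assms(2,3) by (simp add: u_def)
  moreover have "(\<Sum>v\<in>{p, q, r}. u v *\<^sub>R v) = 0"
    using ne assms(4) by (simp add: u_def algebra_simps)
  ultimately have "\<forall>v\<in>{p, q, r}. u v = 0"
    using indep affine_dependent_explicit_finite[of "{p, q, r}"] by auto
  then have "u p = 0" "u q = 0" "u r = 0" by auto
  then show ?thesis using ne by (auto simp: u_def)
qed

text \<open>The ranges of \<open>s\<close> and \<open>t\<close> mirror the indexing of the chords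
  below: the first end may be the corner \<open>p\<close>, the second is strictly inside its side.
  Then all three barycentric coordinates of the midpoint are positive.\<close>

lemma midpoint_in_interior_triangle:
  fixes p q r :: "real^2"
  assumes "\<not> collinear {p, q, r}" "0 \<le> s" "s < 1" "0 < t" "t < 1"
  shows "midpoint (p + s *\<^sub>R (q - p)) (q + t *\<^sub>R (r - q)) \<in> interior (convex hull {p, q, r})"
proof -
  have "((1 - s) / 2) *\<^sub>R p + ((s + 1 - t) / 2) *\<^sub>R q + (t / 2) *\<^sub>R r
      = midpoint (p + s *\<^sub>R (q - p)) (q + t *\<^sub>R (r - q))"
    by (simp add: midpoint_def vec_eq_iff field_simps)
  moreover have "(1 - s) / 2 > 0" "(s + 1 - t) / 2 > 0" "t / 2 > 0"
    "(1 - s) / 2 + (s + 1 - t) / 2 + t / 2 = 1"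
    using assms by (auto simp: field_simps)
  ultimately show ?thesis
    unfolding interior_convex_hull_3_minimal[OF assms(1), simplified] by blast
qed

section \<open>The Wang--Shi split\<close>

lemma card_triangle_indices: "card (SIGMA i:{..d}. {..d - i}) = (d + 2 choose 2)"
proof -
  have "(\<Sum>i\<le>d. Suc (d - i)) = (d + 2 choose 2)"
  proof (induction d)
    case (Suc d)
    have "(\<Sum>i\<le>Suc d. Suc (Suc d - i)) = Suc (Suc d) + (\<Sum>i\<le>d. Suc (d - i))"
      by (subst sum.atMost_Suc_shift) simp
    then show ?case using Suc by (simp add: numeral_2_eq_2)
  qed (simp add: numeral_2_eq_2)
  then show ?thesis by simp
qed

lemma sum_fun_apply: "(\<Sum>i\<in>A. f i) x = (\<Sum>i\<in>A. f i x)"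
  for f :: "'i \<Rightarrow> 'a \<Rightarrow> real"
  by (induction A rule: infinite_finite_induct) (auto simp: zero_fun_def plus_fun_def)

text \<open>With an indexed family, injectivity follows from independence: two equal members with
  coefficients 1 and -1 would give a relation.\<close>

lemma fun_dim_eq_card:
  fixes b :: "'j \<Rightarrow> real^2 \<Rightarrow> real"
  assumes "finite J" and sub: "\<And>j. j \<in> J \<Longrightarrow> b j \<in> S"
    and span: "\<And>f. f \<in> S \<Longrightarrow> \<exists>c. \<forall>x. f x = (\<Sum>j\<in>J. c j * b j x)"
    and indep: "\<And>c j. (\<And>x. (\<Sum>j\<in>J. c j * b j x) = 0) \<Longrightarrow> j \<in> J \<Longrightarrow> c j = 0"
  shows "fun_dim S = card J"
proof -
  interpret V: vector_space "\<lambda>(c::real) (f::real^2 \<Rightarrow> real). \<lambda>x. c * f x"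
    by unfold_locales (auto simp: fun_eq_iff plus_fun_def algebra_simps)
  have inj: "inj_on b J"
  proof (rule inj_onI, rule ccontr)
    fix i j assume ij: "i \<in> J" "j \<in> J" "b i = b j" "i \<noteq> j"
    define c where "c l = (if l = i then 1 else if l = j then - 1 else 0 :: real)" for l
    have "(\<Sum>l\<in>J. c l * b l x) = 0" for x
    proof -
      have "(\<Sum>l\<in>J. c l * b l x) = (\<Sum>l\<in>{i, j}. c l * b l x)"
        by (rule sum.mono_neutral_right) (use assms(1) ij in \<open>auto simp: c_def\<close>)
      then show ?thesis using ij by (simp add: c_def)
    qed
    then have "c i = 0" using ij(1) by (rule indep)
    then show False by (simp add: c_def)
  qed
  have "V.independent (b ` J)"
  proof
    assume "V.dependent (b ` J)"
    then obtain u where u: "\<exists>v\<in>b ` J. u v \<noteq> 0" "(\<Sum>v\<in>b ` J. (\<lambda>x. u v * v x)) = 0"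
      using V.dependent_finite[of "b ` J"] assms(1) by auto
    have "(\<Sum>j\<in>J. u (b j) * b j x) = 0" for x
    proof -
      have "(\<Sum>j\<in>J. u (b j) * b j x) = (\<Sum>v\<in>b ` J. (\<lambda>x. u v * v x)) x"
        unfolding sum_fun_apply by (simp add: sum.reindex[OF inj])
      then show ?thesis by (simp add: u(2))
    qed
    then have "u (b j) = 0" if "j \<in> J" for j using that by (rule indep)
    then show False using u(1) by auto
  qed
  moreover have "S \<subseteq> V.span (b ` J)"
  proof
    fix f assume "f \<in> S"
    then obtain c where "\<forall>x. f x = (\<Sum>j\<in>J. c j * b j x)" using span by blast
    then have "f = (\<Sum>j\<in>J. (\<lambda>x. c j * b j x))"
      by (auto simp: fun_eq_iff sum_fun_apply)
    moreover have "(\<Sum>j\<in>J. (\<lambda>x. c j * b j x)) \<in> V.span (b ` J)"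
      by (intro V.span_sum V.span_scale V.span_base) auto
    ultimately show "f \<in> V.span (b ` J)" by simp
  qed
  ultimately have "V.dim S = card (b ` J)"
    using sub by (intro V.dim_unique[of "b ` J"]) auto
  then show ?thesis by (simp add: fun_dim_def card_image[OF inj])
qed

section \<open>Boundary points and interior chords of the triangle\<close>

locale ws_triangle =
  fixes d :: nat and p1 p2 p3 :: "real^2"
  assumes d_pos: "d > 0" and nondegenerate: "\<not> collinear {p1, p2, p3}"
begin

definition T :: "(real^2) set" where "T = convex hull {p1, p2, p3}"

abbreviation bdry :: "(real^2) set" where "bdry \<equiv> ws_boundary_points d p1 p2 p3"

abbreviation segs :: "(real^2) set set" where "segs \<equiv> ws_segments d p1 p2 p3"

definition corner :: "nat \<Rightarrow> real^2" where "corner e = (if e = 0 then p1 else if e = 1 then p2 else p3)"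

definition succ3 :: "nat \<Rightarrow> nat" where "succ3 e = (if e = 0 then 1 else if e = 1 then 2 else 0)"

text \<open>Sides are oriented cyclically. For \<open>k < d\<close> a corner belongs only to the
  side starting there, so the boundary points are indexed without repetition.\<close>

definition bpoint :: "nat \<Rightarrow> nat \<Rightarrow> real^2" where
  "bpoint e k = corner e + (real k / real d) *\<^sub>R (corner (succ3 e) - corner e)"

lemma bdry_eq: "bdry = (\<lambda>(e, k). bpoint e k) ` ({0, 1, 2} \<times> {..<d})"
proof -
  have "(\<lambda>(e, k). bpoint e k) ` ({0, 1, 2} \<times> {..<d})
      = bpoint 0 ` {..<d} \<union> bpoint 1 ` {..<d} \<union> bpoint 2 ` {..<d}" by auto
  then show ?thesis
    unfolding ws_boundary_points_def by (auto simp: bpoint_def corner_def succ3_def)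
qed

lemma finite_bdry: "finite bdry"
  unfolding bdry_eq by simp

lemma finite_segs: "finite segs"
proof -
  have "segs \<subseteq> (\<lambda>(a, b). closed_segment a b) ` (bdry \<times> bdry)"
    by (auto simp: ws_segments_def)
  then show ?thesis using finite_bdry finite_subset by blast
qed

lemma convex_T: "convex T" and compact_T: "compact T"
  by (simp_all add: T_def finite_imp_compact_convex_hull)

lemma closed_T: "closed T"
  using compact_T by (rule compact_imp_closed)

lemma interior_nonempty: "interior T \<noteq> {}"
  using midpoint_in_interior_triangle[OF nondegenerate, of 0 "1/2"] by (auto simp: T_def)

lemma closure_interior_T: "closure (interior T) = T"
  using convex_closure_interior[OF convex_T interior_nonempty] closed_T by simp

lemma edge_disjoint_interior:
  assumes "e \<in> {0, 1, 2}" shows "closed_segment (corner e) (corner (succ3 e)) \<inter> interior T = {}"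
proof -
  have "closed_segment (corner e) (corner (succ3 e)) \<subseteq> frontier T"
    unfolding T_def frontier_of_triangle[of p1 p2 p3, simplified]
    using assms by (auto simp: corner_def succ3_def)
  then show ?thesis by (auto simp: frontier_def)
qed

lemma bpoint_in_edge: "k \<le> d \<Longrightarrow> bpoint e k \<in> closed_segment (corner e) (corner (succ3 e))"
  using d_pos unfolding in_segment bpoint_def
  by (intro exI[of _ "real k / real d"]) (simp add: algebra_simps divide_le_eq)

lemma bpoint_0: "bpoint e 0 = corner e"
  by (simp add: bpoint_def)

lemma edge_subset_T: "e \<in> {0, 1, 2} \<Longrightarrow> closed_segment (corner e) (corner (succ3 e)) \<subseteq> T"
  unfolding T_def corner_def succ3_def
  by (intro closed_segment_subset convex_convex_hull hull_inc) auto

lemma bdry_in_T: "a \<in> bdry \<Longrightarrow> a \<in> T" and bdry_not_interior: "a \<in> bdry \<Longrightarrow> a \<notin> interior T"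
proof -
  assume "a \<in> bdry"
  then obtain e k where "e \<in> {0, 1, 2}" "k < d" "a = bpoint e k" unfolding bdry_eq by auto
  then show "a \<in> T" "a \<notin> interior T"
    using bpoint_in_edge[of k e] edge_subset_T[of e] edge_disjoint_interior[of e] by auto
qed

lemma bpoint_inj:
  assumes "e \<in> {0, 1, 2}" "e' \<in> {0, 1, 2}" "k < d" "k' < d" "bpoint e k = bpoint e' k'"
  shows "e = e' \<and> k = k'"
proof -
  \<comment> \<open>Barycentric coordinates of the point with parameter \<open>s\<close> on side
    \<open>e\<close>; for \<open>s < 1\<close> they determine both.\<close>
  define x where "x e s = (if e = 0 then 1 - s else if e = 1 then 0 else s)" for e :: nat and s :: real
  define y where "y e s = (if e = 0 then s else if e = 1 then 1 - s else 0)" for e :: nat and s :: real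
  define z where "z e s = (if e = 0 then 0 else if e = 1 then s else 1 - s)" for e :: nat and s :: real
  have coords: "bpoint e k = x e (k / d) *\<^sub>R p1 + y e (k / d) *\<^sub>R p2 + z e (k / d) *\<^sub>R p3"
    if "e \<in> {0, 1, 2}" for e k
    using that by (auto simp: bpoint_def corner_def succ3_def x_def y_def z_def algebra_simps)
  have sum1: "x e s + y e s + z e s = 1" for e s
    by (auto simp: x_def y_def z_def)
  have "x e (k / d) = x e' (k' / d) \<and> y e (k / d) = y e' (k' / d) \<and> z e (k / d) = z e' (k' / d)"
    by (rule barycentric_unique[OF nondegenerate sum1 sum1])
      (use assms(5) coords[OF assms(1)] coords[OF assms(2)] in simp)
  moreover have "real k / d < 1" "real k' / d < 1" using assms by auto
  ultimately have "e = e' \<and> real k / d = real k' / d"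
    using assms(1,2) by (auto simp: x_def y_def z_def split: if_splits)
  then show ?thesis using d_pos by auto
qed

definition I :: "(real^2) set set" where "I = {s \<in> segs. s \<inter> interior T \<noteq> {}}"

lemma finite_I: "finite I"
  using finite_segs by (simp add: I_def)

lemma interior_segment:
  assumes "e \<in> {0, 1, 2}" "k < d" "0 < l" "l < d"
  shows "closed_segment (bpoint e k) (bpoint (succ3 e) l) \<in> I"
proof -
  have set: "{corner e, corner (succ3 e), corner (succ3 (succ3 e))} = {p1, p2, p3}"
    using assms(1) by (auto simp: corner_def succ3_def)
  have "midpoint (bpoint e k) (bpoint (succ3 e) l) \<in> interior T"
    unfolding T_def set[symmetric] bpoint_def
    by (rule midpoint_in_interior_triangle) (use assms d_pos nondegenerate set in auto)
  moreover have "midpoint (bpoint e k) (bpoint (succ3 e) l) \<in> closed_segment (bpoint e k) (bpoint (succ3 e) l)"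
    by simp
  moreover have "succ3 e \<in> {0, 1, 2}" "succ3 e \<noteq> e" using assms(1) by (auto simp: succ3_def)
  then have "bpoint e k \<noteq> bpoint (succ3 e) l"
    using bpoint_inj[of e "succ3 e" k l] assms by auto
  moreover have "bpoint e k \<in> bdry" "bpoint (succ3 e) l \<in> bdry"
    using assms \<open>succ3 e \<in> {0, 1, 2}\<close> by (auto simp: bdry_eq)
  ultimately show ?thesis unfolding I_def ws_segments_def by blast
qed

lemma segment_in_edge:
  assumes "e \<in> {0, 1, 2}" "a \<in> closed_segment (corner e) (corner (succ3 e))"
    "b \<in> closed_segment (corner e) (corner (succ3 e))"
  shows "closed_segment a b \<notin> I"
proof -
  have "closed_segment a b \<subseteq> closed_segment (corner e) (corner (succ3 e))"
    using assms by (intro closed_segment_subset convex_closed_segment)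
  then show ?thesis using edge_disjoint_interior[OF assms(1)] unfolding I_def by blast
qed

text \<open>The ends of an interior chord lie on different sides, and any two sides are cyclic
  neighbours, which orients the chord from \<open>e\<close> to \<open>succ3 e\<close>. The index
  \<open>l = 0\<close> drops out because it is the corner that ends side \<open>e\<close>.\<close>

lemma I_eq:
  "I = (\<lambda>(e, k, l). closed_segment (bpoint e k) (bpoint (succ3 e) l)) ` ({0, 1, 2} \<times> {..<d} \<times> {0<..<d})"
proof (intro equalityI subsetI)
  fix s assume s: "s \<in> I"
  then obtain a b where ab: "a \<in> bdry" "b \<in> bdry" "s = closed_segment a b"
    unfolding I_def ws_segments_def by blast
  then obtain e k e' l where e: "e \<in> {0, 1, 2}" "k < d" "a = bpoint e k"
    and e': "e' \<in> {0, 1, 2}" "l < d" "b = bpoint e' l"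
    unfolding bdry_eq by auto
  have a: "a \<in> closed_segment (corner e) (corner (succ3 e))"
    and b: "b \<in> closed_segment (corner e') (corner (succ3 e'))"
    using e e' bpoint_in_edge by auto
  have "e \<noteq> e'" using segment_in_edge[OF e(1) a] b s ab(3) by blast
  then consider "e' = succ3 e" | "e = succ3 e'"
    using e(1) e'(1) by (auto simp: succ3_def)
  then show "s \<in> (\<lambda>(e, k, l). closed_segment (bpoint e k) (bpoint (succ3 e) l)) ` ({0, 1, 2} \<times> {..<d} \<times> {0<..<d})"
  proof cases
    case 1
    have "l \<noteq> 0"
    proof
      assume "l = 0"
      then have "b \<in> closed_segment (corner e) (corner (succ3 e))"
        using e'(3) 1 by (simp add: bpoint_0)
      then show False using segment_in_edge[OF e(1) a] s ab(3) by blast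
    qed
    then show ?thesis using e e' ab(3) 1 by (intro image_eqI[of _ _ "(e, k, l)"]) auto
  next
    case 2
    have "k \<noteq> 0"
    proof
      assume "k = 0"
      then have "a \<in> closed_segment (corner e') (corner (succ3 e'))"
        using e(3) 2 by (simp add: bpoint_0)
      then show False using segment_in_edge[OF e'(1) _ b] s ab(3) by blast
    qed
    then show ?thesis using e e' ab(3) 2
      by (intro image_eqI[of _ _ "(e', l, k)"]) (auto simp: closed_segment_commute)
  qed
qed (auto intro: interior_segment)

lemma card_I: "card I = 3 * d * (d - 1)"
proof -
  have "inj_on (\<lambda>(e, k, l). closed_segment (bpoint e k) (bpoint (succ3 e) l)) ({0, 1, 2} \<times> {..<d} \<times> {0<..<d})"
  proof -
    have main: "e = e' \<and> k = k' \<and> l = l'"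
      if *: "e \<in> {0, 1, 2::nat}" "k \<in> {..<d}" "l \<in> {0<..<d}"
        "e' \<in> {0, 1, 2::nat}" "k' \<in> {..<d}" "l' \<in> {0<..<d}"
        "closed_segment (bpoint e k) (bpoint (succ3 e) l) = closed_segment (bpoint e' k') (bpoint (succ3 e') l')"
      for e k l e' k' l'
    proof -
      have succ: "succ3 e \<in> {0, 1, 2}" "succ3 e' \<in> {0, 1, 2}" by (auto simp: succ3_def)
      have lt: "k < d" "l < d" "k' < d" "l' < d" using * by auto
      have "bpoint e k = bpoint e' k' \<and> bpoint (succ3 e) l = bpoint (succ3 e') l' \<or>
          bpoint e k = bpoint (succ3 e') l' \<and> bpoint (succ3 e) l = bpoint e' k'"
        using *(7) by (simp add: doubleton_eq_iff)
      then show ?thesis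
      proof
        assume "bpoint e k = bpoint e' k' \<and> bpoint (succ3 e) l = bpoint (succ3 e') l'"
        then show ?thesis
          using bpoint_inj[OF *(1,4) lt(1,3)] bpoint_inj[OF succ lt(2,4)] by blast
      next
        assume "bpoint e k = bpoint (succ3 e') l' \<and> bpoint (succ3 e) l = bpoint e' k'"
        \<comment> \<open>A reversed chord would make \<open>succ3\<close> an involution at
          \<open>e'\<close>, but it is a cycle of length three.\<close>
        then have "e = succ3 e'" "succ3 e = e'"
          using bpoint_inj[OF *(1) succ(2) lt(1,4)] bpoint_inj[OF succ(1) *(4) lt(2,3)] by auto
        then show ?thesis by (auto simp: succ3_def split: if_splits)
      qed
    qed
    show ?thesis
    proof (rule inj_onI)
      fix u v
      assume uv: "u \<in> {0, 1, 2} \<times> {..<d} \<times> {0<..<d}" "v \<in> {0, 1, 2} \<times> {..<d} \<times> {0<..<d}"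
        "(\<lambda>(e, k, l). closed_segment (bpoint e k) (bpoint (succ3 e) l)) u
          = (\<lambda>(e, k, l). closed_segment (bpoint e k) (bpoint (succ3 e) l)) v"
      obtain e k l where u: "u = (e, k, l)" by (cases u)
      obtain e' k' l' where v: "v = (e', k', l')" by (cases v)
      show "u = v"
        using main[of e k l e' k' l'] uv unfolding u v
        by (simp only: mem_Times_iff fst_conv snd_conv prod.case Pair_inject simp_thms)
    qed
  qed
  then have "card I = card ({0, 1, 2::nat} \<times> {..<d} \<times> {0<..<d})"
    unfolding I_eq by (rule card_image)
  then show ?thesis by simp
qed

section \<open>The chords as a line arrangement\<close>

definition ends :: "(real^2) set \<Rightarrow> (real^2) \<times> (real^2)" where
  "ends s = (SOME e. fst e \<in> bdry \<and> snd e \<in> bdry \<and> closed_segment (fst e) (snd e) = s)"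

text \<open>A segment is known as a point set only, so its ends are chosen; exchanging them would
  negate \<open>normal\<close> and \<open>offset\<close> together and keep the line.\<close>

definition normal :: "(real^2) set \<Rightarrow> real^2" where "normal s = perp (snd (ends s) - fst (ends s))"

definition offset :: "(real^2) set \<Rightarrow> real" where "offset s = normal s \<bullet> fst (ends s)"

lemma ends:
  assumes "s \<in> segs"
  shows "fst (ends s) \<in> bdry" "snd (ends s) \<in> bdry" "closed_segment (fst (ends s)) (snd (ends s)) = s"
proof -
  obtain a b where "a \<in> bdry" "b \<in> bdry" "closed_segment a b = s"
    using assms unfolding ws_segments_def by blast
  then have "\<exists>e. fst e \<in> bdry \<and> snd e \<in> bdry \<and> closed_segment (fst e) (snd e) = s"
    by (intro exI[of _ "(a, b)"]) simp
  from someI_ex[OF this] show "fst (ends s) \<in> bdry" "snd (ends s) \<in> bdry"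
    "closed_segment (fst (ends s)) (snd (ends s)) = s"
    unfolding ends_def by blast+
qed

lemma line_section: "s \<in> I \<Longrightarrow> {x \<in> T. normal s \<bullet> x = offset s} = s"
proof -
  assume s: "s \<in> I"
  then have "s \<in> segs" by (simp add: I_def)
  note e = ends[OF this]
  have "{x \<in> T. normal s \<bullet> x = offset s} = closed_segment (fst (ends s)) (snd (ends s))"
    unfolding normal_def offset_def
  proof (rule chord_eq_line_section[OF convex_T])
    show "closed_segment (fst (ends s)) (snd (ends s)) \<inter> interior T \<noteq> {}"
      using s e(3) by (simp add: I_def)
  qed (use e bdry_in_T bdry_not_interior in auto)
  then show ?thesis using e(3) by simp
qed

lemma normal_nonzero: "s \<in> I \<Longrightarrow> normal s \<noteq> 0"
proof
  assume s: "s \<in> I" "normal s = 0"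
  then have "s \<in> segs" by (simp add: I_def)
  note e = ends[OF this]
  have "fst (ends s) = snd (ends s)" using s(2) by (simp add: normal_def)
  then have "s = {fst (ends s)}" using e(3) by simp
  moreover obtain x where "x \<in> s" "x \<in> interior T" using s(1) by (auto simp: I_def)
  ultimately have "fst (ends s) \<in> interior T" by (metis singletonD)
  then show False using e(1) bdry_not_interior by blast
qed

text \<open>Two chords on one line would both be the full section of \<open>T\<close> by it, so
  different chords span different lines.\<close>

sublocale line_arrangement "interior T" I normal offset
proof
  show "open (interior T)" "convex (interior T)" "finite I"
    using convex_T finite_I by (auto intro: convex_interior)
  show "normal s \<noteq> 0" if "s \<in> I" for s using that by (rule normal_nonzero)
  show "x = y" if s: "s \<in> I" and t: "t \<in> I" and "s \<noteq> t"
    and x: "normal s \<bullet> x = offset s" "normal t \<bullet> x = offset t"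
    and y: "normal s \<bullet> y = offset s" "normal t \<bullet> y = offset t" for s t x y
  proof (rule ccontr)
    assume "x \<noteq> y"
    have "{z \<in> T. normal s \<bullet> z = offset s} = {z \<in> T. normal t \<bullet> z = offset t}"
    proof -
      have "normal s \<bullet> (z - x) = 0 \<longleftrightarrow> normal t \<bullet> (z - x) = 0" for z
      proof -
        have "normal s \<bullet> (y - x) = 0" "normal t \<bullet> (y - x) = 0"
          using x y by (simp_all add: inner_diff_right)
        then show ?thesis
          using inner_eq_0_iff_perp[of "normal s" "y - x" "z - x"]
            inner_eq_0_iff_perp[of "normal t" "y - x" "z - x"]
            normal_nonzero s t \<open>x \<noteq> y\<close> by auto
      qed
      then have "normal s \<bullet> z = offset s \<longleftrightarrow> normal t \<bullet> z = offset t" for z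
        using x by (simp add: inner_diff_right)
      then show ?thesis by simp
    qed
    then have "s = t" unfolding line_section[OF s] line_section[OF t] .
    then show False using \<open>s \<noteq> t\<close> by blast
  qed
qed

section \<open>Sign cells and polygons of the split\<close>

lemma lam_eq_0_iff: "s \<in> I \<Longrightarrow> x \<in> T \<Longrightarrow> lam s x = 0 \<longleftrightarrow> x \<in> s"
  using line_section[of s] by (auto simp: lam_def)

lemma edge_in_segs:
  assumes "e \<in> {0, 1, 2}" shows "closed_segment (corner e) (corner (succ3 e)) \<in> segs"
proof -
  have succ: "succ3 e \<in> {0, 1, 2}" "succ3 e \<noteq> e" using assms by (auto simp: succ3_def)
  have "corner e = bpoint e 0" "corner (succ3 e) = bpoint (succ3 e) 0" by (simp_all add: bpoint_0)
  moreover have "bpoint e 0 \<noteq> bpoint (succ3 e) 0"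
    using bpoint_inj[OF assms succ(1) d_pos d_pos] succ(2) by auto
  moreover have "bpoint e 0 \<in> bdry" "bpoint (succ3 e) 0 \<in> bdry"
    using assms succ d_pos by (auto simp: bdry_eq)
  ultimately show ?thesis unfolding ws_segments_def by auto
qed

text \<open>The sides are themselves segments of the split, so removing all segments removes the
  frontier; inside, only chords matter.\<close>

lemma regular_eq: "T - \<Union>segs = regular"
proof (intro equalityI subsetI)
  fix x assume x: "x \<in> T - \<Union>segs"
  have "x \<in> interior T"
  proof (rule ccontr)
    assume "x \<notin> interior T"
    then have "x \<in> frontier T" using x closed_T by (simp add: frontier_def)
    then have "\<exists>e\<in>{0, 1, 2}. x \<in> closed_segment (corner e) (corner (succ3 e))"
      unfolding T_def frontier_of_triangle[of p1 p2 p3, simplified]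
      by (auto simp: corner_def succ3_def)
    then show False using edge_in_segs x by blast
  qed
  then show "x \<in> regular"
    using x lam_eq_0_iff unfolding regular_def by (auto simp: I_def)
next
  fix x assume x: "x \<in> regular"
  then have "x \<in> interior T" by (simp add: regular_def)
  then have "x \<in> T" using interior_subset by blast
  moreover have "x \<notin> s" if "s \<in> segs" for s
  proof
    assume "x \<in> s"
    then have "s \<in> I" using that \<open>x \<in> interior T\<close> by (auto simp: I_def)
    then show False using x \<open>x \<in> s\<close> lam_eq_0_iff \<open>x \<in> T\<close> by (auto simp: regular_def)
  qed
  ultimately show "x \<in> T - \<Union>segs" by blast
qed

lemma ws_cells_eq: "ws_cells d p1 p2 p3 = closure ` components regular"
  unfolding ws_cells_def T_def[symmetric] regular_eq ..

lemma ws_cell_subset: "P \<in> ws_cells d p1 p2 p3 \<Longrightarrow> P \<subseteq> T"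
proof -
  assume "P \<in> ws_cells d p1 p2 p3"
  then obtain C where C: "C \<in> components regular" "P = closure C" unfolding ws_cells_eq by blast
  have "C \<subseteq> T"
    using in_components_subset[OF C(1)] interior_subset[of T] by (auto simp: regular_def)
  then show "P \<subseteq> T" unfolding C(2) using closed_T by (rule closure_minimal)
qed

text \<open>A convex cell is connected and hence lies in one component; this carries polynomial
  pieces from polygons to cells.\<close>

lemma cell_subset_ws_cell:
  assumes "x \<in> regular" shows "\<exists>P\<in>ws_cells d p1 p2 p3. cell x \<subseteq> P"
proof -
  have "x \<in> cell x" using assms by (auto simp: cell_def regular_def)
  have "cell x \<subseteq> connected_component_set regular x"
    using \<open>x \<in> cell x\<close> cell_subset_regular[OF assms] convex_connected[OF convex_cell[OF assms]]
    by (intro connected_component_maximal)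
  moreover have "connected_component_set regular x \<in> components regular"
    using assms by (rule componentsI)
  ultimately show ?thesis
    unfolding ws_cells_eq by (meson closure_subset imageI order_trans)
qed

text \<open>The affine form is continuous without zeros on a connected component, and closure keeps
  its weak sign. Truncated powers are therefore polynomial on each polygon.\<close>

lemma ws_cell_one_side:
  assumes P: "P \<in> ws_cells d p1 p2 p3" and s: "s \<in> I"
  shows "(\<forall>x\<in>P. lam s x \<ge> 0) \<or> (\<forall>x\<in>P. lam s x \<le> 0)"
proof -
  obtain C where C: "C \<in> components regular" "P = closure C"
    using P unfolding ws_cells_eq by blast
  have con: "connected (lam s ` C)"
    unfolding lam_def using in_components_connected[OF C(1)]
    by (intro connected_continuous_image continuous_intros)
  have nz: "0 \<notin> lam s ` C"
    using in_components_subset[OF C(1)] s by (auto simp: regular_def)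
  have "C \<subseteq> {x. lam s x \<ge> 0} \<or> C \<subseteq> {x. lam s x \<le> 0}"
  proof (rule ccontr)
    assume "\<not> ?thesis"
    then obtain a b where "a \<in> C" "\<not> lam s a \<ge> 0" "b \<in> C" "\<not> lam s b \<le> 0" by blast
    then have "0 \<in> lam s ` C"
      using connected_contains_Icc[OF con, of "lam s a" "lam s b"] by auto
    then show False using nz by blast
  qed
  moreover have "closed {x. lam s x \<ge> 0}" "closed {x. lam s x \<le> 0}"
    unfolding lam_def by (intro closed_Collect_le continuous_intros)+
  ultimately show ?thesis
    using closure_minimal[of C] unfolding C(2) by blast
qed

section \<open>The basis of the spline space and its dimension\<close>

definition restr :: "(real^2 \<Rightarrow> real) \<Rightarrow> real^2 \<Rightarrow> real" where
  "restr g x = (if x \<in> T then g x else 0)"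

lemma restr_in_spline_space:
  assumes "continuous_on UNIV g" "Ck_on (d - 1) (interior T) g"
    and "\<And>P. P \<in> ws_cells d p1 p2 p3 \<Longrightarrow> \<exists>p. bipoly_deg_le d p \<and> (\<forall>x\<in>P. g x = p x)"
  shows "restr g \<in> ws_spline_space d p1 p2 p3"
proof -
  have "continuous_on T (restr g)"
    using continuous_on_subset[OF assms(1), of T] by (simp add: restr_def cong: continuous_on_cong)
  moreover have "Ck_on (d - 1) (interior T) (restr g)"
    by (rule Ck_on_cong[OF open_interior _ assms(2)]) (use interior_subset in \<open>auto simp: restr_def\<close>)
  moreover have "\<exists>p. bipoly_deg_le d p \<and> (\<forall>x\<in>P. restr g x = p x)" if P: "P \<in> ws_cells d p1 p2 p3" for P
  proof -
    obtain p where "bipoly_deg_le d p" "\<forall>x\<in>P. g x = p x" using assms(3)[OF P] by blast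
    then show ?thesis using ws_cell_subset[OF P] by (intro exI[of _ p]) (auto simp: restr_def)
  qed
  ultimately show ?thesis
    unfolding ws_spline_space_def C_on_triangle_def T_def[symmetric] by (auto simp: restr_def)
qed

lemma trunc_power_in_spline_space:
  assumes s: "s \<in> I"
  shows "restr (\<lambda>x. max 0 (lam s x) ^ d) \<in> ws_spline_space d p1 p2 p3"
proof (rule restr_in_spline_space)
  show "continuous_on UNIV (\<lambda>x. max 0 (lam s x) ^ d)"
    unfolding lam_def by (intro continuous_intros)
  show "Ck_on (d - 1) (interior T) (\<lambda>x. max 0 (lam s x) ^ d)"
    \<comment> \<open>With \<open>m = 0\<close> the exponent \<open>Suc (d - 1)\<close> is
      \<open>d\<close>, as \<open>d\<close> is positive.\<close>
    using Ck_on_trunc_power[of "interior T" "d - 1" "normal s" "offset s" 0] d_pos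
    by (simp add: lam_def)
  fix P assume "P \<in> ws_cells d p1 p2 p3"
  from ws_cell_one_side[OF this s]
  show "\<exists>p. bipoly_deg_le d p \<and> (\<forall>x\<in>P. max 0 (lam s x) ^ d = p x)"
  proof
    assume "\<forall>x\<in>P. lam s x \<ge> 0"
    moreover have "bipoly_deg_le d (\<lambda>x. lam s x ^ d)"
      using bipoly_power[OF bipoly_affine[of "normal s" "offset s"], of d] by (simp add: lam_def)
    ultimately show ?thesis by (intro exI[of _ "\<lambda>x. lam s x ^ d"]) auto
  next
    assume "\<forall>x\<in>P. lam s x \<le> 0"
    then show ?thesis
      using d_pos by (intro exI[of _ "\<lambda>x. 0"]) (auto simp: bipoly_const zero_power)
  qed
qed

lemma monomial_in_spline_space:
  assumes "i + j \<le> d"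
  shows "restr (\<lambda>x. (x$1) ^ i * (x$2) ^ j) \<in> ws_spline_space d p1 p2 p3"
  using bipoly_monom[OF assms]
  by (intro restr_in_spline_space Ck_on_bipoly[OF open_interior]
      Ck_on_continuous[OF Ck_on_bipoly[OF open_UNIV, where k = 0]]) auto

lemma arrangement_spline_if_spline:
  assumes mult: "\<forall>v\<in>interior T. card {s \<in> segs. v \<in> s} \<le> d + 1"
    and f: "f \<in> ws_spline_space d p1 p2 p3"
  shows "arrangement_spline (interior T) I normal offset d f"
proof (intro arrangement_spline.intro arrangement_spline_axioms.intro)
  show "line_arrangement (interior T) I normal offset" by (rule line_arrangement_axioms)
  show "d > 0" by (rule d_pos)
  show "Ck_on (d - 1) (interior T) f"
    using f by (simp add: ws_spline_space_def C_on_triangle_def T_def)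
  show "\<exists>p. bipoly_deg_le d p \<and> (\<forall>y\<in>cell x. f y = p y)" if x: "x \<in> regular" for x
  proof -
    obtain P where P: "P \<in> ws_cells d p1 p2 p3" "cell x \<subseteq> P"
      using cell_subset_ws_cell[OF x] by blast
    then obtain p where "bipoly_deg_le d p" "\<forall>y\<in>P. f y = p y"
      using f unfolding ws_spline_space_def by blast
    then show ?thesis using P(2) by blast
  qed
  show "card {s \<in> I. lam s v = 0} \<le> d + 1" if v: "v \<in> interior T" for v
  proof -
    have "{s \<in> I. lam s v = 0} \<subseteq> {s \<in> segs. v \<in> s}"
      using v interior_subset[of T] lam_eq_0_iff by (auto simp: I_def)
    then have "card {s \<in> I. lam s v = 0} \<le> card {s \<in> segs. v \<in> s}"
      using finite_segs by (intro card_mono) auto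
    also have "\<dots> \<le> d + 1" using mult v by blast
    finally show ?thesis .
  qed
qed

text \<open>The representation holds on the interior and extends by continuity, since
  \<open>T\<close> is the closure of its interior.\<close>

lemma spline_eq_poly_plus_trunc_powers:
  assumes "\<forall>v\<in>interior T. card {s \<in> segs. v \<in> s} \<le> d + 1"
    and f: "f \<in> ws_spline_space d p1 p2 p3"
  shows "\<exists>p c. bipoly_deg_le d p \<and>
    (\<forall>x. f x = restr (\<lambda>x. p x + (\<Sum>s\<in>I. c s * max 0 (lam s x) ^ d)) x)"
proof -
  obtain p c where p: "bipoly_deg_le d p"
    and eq: "\<forall>x\<in>interior T. f x = p x + (\<Sum>s\<in>I. c s * max 0 (lam s x) ^ d)"
    using arrangement_spline.representation[OF arrangement_spline_if_spline[OF assms]]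
    by (elim exE conjE)
  define h where "h x = f x - (p x + (\<Sum>s\<in>I. c s * max 0 (lam s x) ^ d))" for x
  have "continuous_on T p"
    using Ck_on_continuous[OF Ck_on_bipoly[OF open_UNIV p, of 0]] continuous_on_subset by blast
  moreover have "continuous_on T f"
    using f by (simp add: ws_spline_space_def C_on_triangle_def T_def)
  ultimately have "continuous_on T h"
    unfolding h_def lam_def by (intro continuous_intros)
  then have "closed {x \<in> T. h x = 0}"
    using closed_T by (rule continuous_closed_preimage_constant)
  moreover have "interior T \<subseteq> {x \<in> T. h x = 0}"
    using eq interior_subset by (auto simp: h_def)
  ultimately have "closure (interior T) \<subseteq> {x \<in> T. h x = 0}"
    by (rule closure_minimal[rotated])
  then have on_T: "f x = p x + (\<Sum>s\<in>I. c s * max 0 (lam s x) ^ d)" if "x \<in> T" for x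
    using that unfolding closure_interior_T by (auto simp: h_def)
  moreover have "f x = 0" if "x \<notin> T" for x
    using f that by (simp add: ws_spline_space_def T_def)
  ultimately show ?thesis
    using p by (intro exI[of _ p] exI[of _ c]) (auto simp: restr_def)
qed

text \<open>Monomials are indexed by exponents, truncated powers by chords; the two cardinalities
  are the two terms of the dimension.\<close>

definition basis_index :: "(nat \<times> nat + (real^2) set) set" where
  "basis_index = (SIGMA i:{..d}. {..d - i}) <+> I"

definition basis_fun :: "nat \<times> nat + (real^2) set \<Rightarrow> real^2 \<Rightarrow> real" where
  "basis_fun m = (case m of Inl (i, j) \<Rightarrow> restr (\<lambda>x. (x$1) ^ i * (x$2) ^ j)
     | Inr s \<Rightarrow> restr (\<lambda>x. max 0 (lam s x) ^ d))"

lemma sum_basis_fun: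
  "(\<Sum>m\<in>basis_index. c m * basis_fun m x) =
    restr (\<lambda>x. (\<Sum>i\<le>d. \<Sum>j\<le>d - i. c (Inl (i, j)) * (x$1) ^ i * (x$2) ^ j)
      + (\<Sum>s\<in>I. c (Inr s) * max 0 (lam s x) ^ d)) x"
proof -
  have "(\<Sum>m\<in>basis_index. c m * basis_fun m x) =
      (\<Sum>m\<in>(SIGMA i:{..d}. {..d - i}). c (Inl m) * basis_fun (Inl m) x)
      + (\<Sum>s\<in>I. c (Inr s) * basis_fun (Inr s) x)"
    unfolding basis_index_def by (subst sum.Plus) (auto simp: finite_I)
  also have "(\<Sum>m\<in>(SIGMA i:{..d}. {..d - i}). c (Inl m) * basis_fun (Inl m) x)
      = (\<Sum>i\<le>d. \<Sum>j\<le>d - i. c (Inl (i, j)) * basis_fun (Inl (i, j)) x)"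
    by (subst sum.Sigma) (auto simp: split_beta)
  finally show ?thesis
    by (simp add: basis_fun_def restr_def mult.assoc)
qed

theorem fun_dim_spline_space:
  assumes mult: "\<forall>v\<in>interior T. card {s \<in> segs. v \<in> s} \<le> d + 1"
  shows "fun_dim (ws_spline_space d p1 p2 p3) = (d + 2 choose 2) + 3 * d * (d - 1)"
proof -
  have "fun_dim (ws_spline_space d p1 p2 p3) = card basis_index"
  proof (rule fun_dim_eq_card)
    show "finite basis_index" by (simp add: basis_index_def finite_I)
    show "basis_fun m \<in> ws_spline_space d p1 p2 p3" if "m \<in> basis_index" for m
      using that monomial_in_spline_space trunc_power_in_spline_space
      by (auto simp: basis_index_def basis_fun_def)
    show "\<exists>c. \<forall>x. f x = (\<Sum>m\<in>basis_index. c m * basis_fun m x)"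
      if f: "f \<in> ws_spline_space d p1 p2 p3" for f
    proof -
      obtain p c where p: "bipoly_deg_le d p"
        and fx: "\<forall>x. f x = restr (\<lambda>x. p x + (\<Sum>s\<in>I. c s * max 0 (lam s x) ^ d)) x"
        using spline_eq_poly_plus_trunc_powers[OF mult f] by (elim exE conjE)
      obtain a where a: "\<forall>x. p x = (\<Sum>i\<le>d. \<Sum>j\<le>d - i. a i j * (x$1) ^ i * (x$2) ^ j)"
        using p unfolding bipoly_deg_le_def by (elim exE)
      show ?thesis
        unfolding sum_basis_fun fx[rule_format]
        by (intro exI[of _ "\<lambda>m. case m of Inl (i, j) \<Rightarrow> a i j | Inr s \<Rightarrow> c s"]) (simp add: a)
    qed
    show "c m = 0" if zero: "\<And>x. (\<Sum>m\<in>basis_index. c m * basis_fun m x) = 0" and m: "m \<in> basis_index" for c m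
    proof -
      define p where "p x = (\<Sum>i\<le>d. \<Sum>j\<le>d - i. c (Inl (i, j)) * (x$1) ^ i * (x$2) ^ j)" for x :: "real^2"
      have p: "bipoly_deg_le d p" unfolding p_def bipoly_deg_le_def
        by (rule exI[of _ "\<lambda>i j. c (Inl (i, j))"]) simp
      have zero': "p x + (\<Sum>s\<in>I. c (Inr s) * max 0 (lam s x) ^ d) = 0" if "x \<in> interior T" for x
        using zero[of x] that interior_subset[of T] unfolding sum_basis_fun p_def
        by (auto simp: restr_def)
      \<comment> \<open>Truncated powers are eliminated first; what remains is a polynomial that
        vanishes on the nonempty interior.\<close>
      have trunc: "c (Inr s) = 0" if s: "s \<in> I" for s
      proof -
        obtain z where "z \<in> s" "z \<in> interior T" using s by (auto simp: I_def)
        moreover from this have "lam s z = 0"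
          using lam_eq_0_iff[OF s] interior_subset by blast
        ultimately show ?thesis
          using trunc_powers_independent[OF p d_pos zero' s, of z] by blast
      qed
      have p0: "p x = 0" for x
      proof -
        obtain z where "z \<in> interior T" using interior_nonempty by blast
        then show ?thesis
          by (rule bipoly_eq_0_if_open[OF p open_interior]) (use zero' trunc in simp)
      qed
      have "c (Inl (i, j)) = 0" if "i + j \<le> d" for i j
      proof (rule bipoly_coeffs_eq_0[where c = "\<lambda>i j. c (Inl (i, j))"])
        show "(\<Sum>i\<le>d. \<Sum>j\<le>d - i. c (Inl (i, j)) * s ^ i * t ^ j) = 0" for s t
          using p0[of "vector [s, t]"] by (simp add: p_def)
      qed (rule that)
      then show ?thesis using m trunc by (auto simp: basis_index_def)
    qed
  qed
  also have "\<dots> = (d + 2 choose 2) + 3 * d * (d - 1)"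
    unfolding basis_index_def
    by (subst card_Plus) (simp_all only: card_triangle_indices card_I finite_I finite_SigmaI finite_atMost)
  finally show ?thesis .
qed

end

theorem theorem2p2:
  fixes d :: nat and p1 p2 p3 :: "real^2"
  assumes "d \<ge> 1"
    and "\<not> collinear {p1, p2, p3}"
    and "\<forall>v \<in> interior (convex hull {p1, p2, p3}).
           card {s \<in> ws_segments d p1 p2 p3. v \<in> s} \<le> d + 1"
  shows "fun_dim (ws_spline_space d p1 p2 p3) = (d + 2 choose 2) + 3 * d * (d - 1)"
proof -
  interpret ws_triangle d p1 p2 p3
    using assms by unfold_locales auto
  show ?thesis
    by (rule fun_dim_spline_space) (use assms(3) in \<open>simp add: T_def\<close>)
qed

end
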